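(* Let $\lambda\in\mathbb{C}$ be nonzero and let $\mathcal{G}_\lambda$ be the weighted model of walks with steps $(-1,-1)$, $(0,1)$, $(1,0)$, $(2,1)$, $(1,-1)$, where the step $(1,0)$ has weight $\lambda$ and all other steps have weight $1$. Let $Q(X,Y,t)=\sum_{i,j,n\ge 0}q_{i,j,n}X^iY^jt^n$ be the generating function of weighted walks in the quarter plane on $\mathcal{G}_\lambda$ starting at $(0,0)$. Then the series $Q(X,0,t)$ and $Q(0,Y,t)$ are algebraic over $\mathbb{C}(X,Y,t)$, and so is the generating function $Q(X,Y,t)$.
   Context: A weighted walk in the quarter plane of length $n$ on a model with finite step set $\mathcal{S}\subset\mathbb{Z}\times\mathbb{Z}$ and nonzero complex weights $(w_s)_{s\in\mathcal{S}}$ is a sequence of points $P_0,\dots,P_n$ in $\mathbb{N}\times\mathbb{N}$ (with $0\in\mathbb{N}$) such that for each $i$ there is $s_i\in\mathcal{S}$ with $P_{i+1}=P_i+s_i$; its weight is $w_{s_0}w_{s_1}\cdots w_{s_{n-1}}$. The coefficient $q_{i,j,n}$ is the sum of the weights of all such walks of length $n$ with $P_0=(0,0)$ and $P_n=(i,j)$. A power series is algebraic over $\mathbb{C}(X,Y,t)$ if it is a root of a nonzero univariate polynomial with coefficients in $\mathbb{C}(X,Y,t)$. *)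

theory Defs
  imports
    "HOL-Library.Product_Plus"
    "HOL-Computational_Algebra.Computational_Algebra"
begin

section \<open>Weighted walks in the quarter plane\<close>

text \<open>A walk of length \<open>n\<close> is the list \<open>[P\<^sub>0, \<dots>, P\<^sub>n]\<close> of its \<open>n + 1\<close> points.\<close>

definition quadrant_walks ::
  "(int \<times> int) set \<Rightarrow> nat \<Rightarrow> (int \<times> int) list set" where
  "quadrant_walks S n =
     {P. length P = n + 1 \<and>
         (\<forall>k\<le>n. 0 \<le> fst (P ! k) \<and> 0 \<le> snd (P ! k)) \<and>
         (\<forall>k<n. \<exists>s\<in>S. P ! (k + 1) = P ! k + s)}"

text \<open>The step \<open>s\<close> from \<open>P\<^sub>k\<close> to \<open>P\<^sub>k\<^sub>+\<^sub>1\<close> is determined by the points, hence is written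
  as their difference.\<close>

definition walk_weight :: "(int \<times> int \<Rightarrow> complex) \<Rightarrow> (int \<times> int) list \<Rightarrow> complex" where
  "walk_weight w P = (\<Prod>k<length P - 1. w (P ! (k + 1) - P ! k))"

definition walk_coeff ::
  "(int \<times> int) set \<Rightarrow> (int \<times> int \<Rightarrow> complex) \<Rightarrow> nat \<Rightarrow> nat \<Rightarrow> nat \<Rightarrow> complex" where
  "walk_coeff S w i j n =
     (\<Sum>P | P \<in> quadrant_walks S n \<and> P ! 0 = (0, 0) \<and> P ! n = (int i, int j).
        walk_weight w P)"

text \<open>For a finite step set the sum above ranges over a finite set.\<close>

lemma finite_quadrant_walks_from:
  assumes "finite S"
  shows "finite {P \<in> quadrant_walks S n. P ! 0 = p}"
proof (induction n)
  case 0
  have "{P \<in> quadrant_walks S 0. P ! 0 = p} \<subseteq> {[p]}"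
    by (auto simp: quadrant_walks_def length_Suc_conv)
  then show ?case
    by (rule finite_subset) simp
next
  case (Suc n)
  let ?W = "{P \<in> quadrant_walks S n. P ! 0 = p}"
  have "{P \<in> quadrant_walks S (Suc n). P ! 0 = p} \<subseteq>
      (\<lambda>(P, s). P @ [P ! n + s]) ` (?W \<times> S)"
  proof
    fix P assume P: "P \<in> {P \<in> quadrant_walks S (Suc n). P ! 0 = p}"
    then have len: "length P = n + 2"
      by (simp add: quadrant_walks_def)
    obtain s where s: "s \<in> S" "P ! (n + 1) = P ! n + s"
      using P by (auto simp: quadrant_walks_def)
    have "take (n + 1) P \<in> ?W"
      using P len by (auto simp: quadrant_walks_def)
    moreover have "P = take (n + 1) P @ [take (n + 1) P ! n + s]"
      using len s(2) take_Suc_conv_app_nth[of "n + 1" P] by simp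
    ultimately show "P \<in> (\<lambda>(P, s). P @ [P ! n + s]) ` (?W \<times> S)"
      using s(1) by (intro image_eqI[of _ _ "(take (n + 1) P, s)"]) auto
  qed
  then show ?case
    by (rule finite_subset) (use Suc.IH assms in auto)
qed

section \<open>Formal power series in \<open>X\<close>, \<open>Y\<close>, \<open>t\<close>\<close>

text \<open>
  \<open>\<complex>[[X, Y, t]]\<close> is represented as the iterated ring \<open>\<complex>[[X]][[Y]][[t]]\<close>: the coefficient of
  \<open>X\<^sup>i Y\<^sup>j t\<^sup>n\<close> in \<open>F\<close> is \<open>F $ n $ j $ i\<close>.
\<close>

type_synonym series3 = "complex fps fps fps"

definition walk_series ::
  "(int \<times> int) set \<Rightarrow> (int \<times> int \<Rightarrow> complex) \<Rightarrow> series3" where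
  "walk_series S w = Abs_fps (\<lambda>n. Abs_fps (\<lambda>j. Abs_fps (\<lambda>i. walk_coeff S w i j n)))"

definition subst_X0 :: "series3 \<Rightarrow> series3" where
  "subst_X0 F = Abs_fps (\<lambda>n. Abs_fps (\<lambda>j. fps_const (F $ n $ j $ 0)))"

definition subst_Y0 :: "series3 \<Rightarrow> series3" where
  "subst_Y0 F = Abs_fps (\<lambda>n. fps_const (F $ n $ 0))"

definition polynomial_series :: "series3 \<Rightarrow> bool" where
  "polynomial_series F \<longleftrightarrow> finite {(i, j, n). F $ n $ j $ i \<noteq> 0}"

text \<open>The field \<open>\<complex>(X, Y, t)\<close>, as a subfield of the fraction field of \<open>\<complex>[[X, Y, t]]\<close>.\<close>

definition rational_functions :: "series3 fract set" where
  "rational_functions =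
     {Fract p q | p q. polynomial_series p \<and> polynomial_series q \<and> q \<noteq> 0}"

definition algebraic_over :: "'a::field set \<Rightarrow> 'a \<Rightarrow> bool" where
  "algebraic_over K x \<longleftrightarrow> (\<exists>p. p \<noteq> 0 \<and> (\<forall>i. coeff p i \<in> K) \<and> poly p x = 0)"

definition algebraic_series :: "series3 \<Rightarrow> bool" where
  "algebraic_series F \<longleftrightarrow> algebraic_over rational_functions (to_fract F)"

section \<open>The model \<open>\<G>\<^sub>\<lambda>\<close>\<close>

definition G_steps :: "(int \<times> int) set" where
  "G_steps = {(-1, -1), (0, 1), (1, 0), (2, 1), (1, -1)}"

definition G_weight :: "complex \<Rightarrow> int \<times> int \<Rightarrow> complex" where
  "G_weight l s = (if s = (1, 0) then l else 1)"

end

theory Submission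
  imports Defs "HOL-Algebra.Algebraic_Closure_Type"
begin

text \<open>
  With \<open>a = 1 + x\<^sup>2\<close> the kernel is \<open>K = x y - t (a (x y\<^sup>2 + 1) + \<lambda> x\<^sup>2 y)\<close>. On the curve \<open>K = 0\<close> put
  \<open>z = 1 / (x y)\<close>; then \<open>y\<close> and \<open>z\<close> are two roots of one quartic
  \<open>Y\<^sup>4 - Y\<^sup>3 / t + e Y\<^sup>2 - \<lambda> Y - 1\<close>. Hence \<open>e = J(y) = 1 / y\<^sup>2 + \<lambda> / y + y / t - y\<^sup>2\<close> equals a rational
  function \<open>I(x)\<close> modulo \<open>K\<close>, and \<open>x y = 1 / z = (1 / y + 1 / z) - 1 / y\<close> decouples. The functional
  equation therefore says \<open>U(x) = V(y)\<close> modulo \<open>K\<close>, where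
  \<open>U = x (1 - \<lambda> t x) / (t a) - t a Q(x, 0)\<close> and \<open>V = 1 / y + t (Q(0, y) - Q(0, 0))\<close>.

  For suitable \<open>u\<^sub>0\<close>, \<open>c\<close> the combination \<open>(J - V\<^sup>2 - \<lambda> V - c) (V - u\<^sub>0)\<close> and its analogue in \<open>I\<close>, \<open>U\<close> have no
  poles at \<open>y = 0\<close> and \<open>x = 0\<close>. As \<open>K\<close> is \<open>x y\<close> minus \<open>t\<close> times a unit, a difference \<open>F(x) - G(y)\<close>
  of power series divisible by \<open>K\<close> vanishes, so both combinations equal a series \<open>r\<close> in \<open>t\<close> alone, and
  \<open>J(y) = \<Phi>(V(y))\<close> for the rational function \<open>\<Phi>(v) = v\<^sup>2 + \<lambda> v + c + r / (v - u\<^sub>0)\<close>. At the three small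
  critical points of \<open>J\<close>, which are power series in \<open>t\<^sup>1\<^sup>/\<^sup>3\<close>, the derivative of \<open>\<Phi>\<close> vanishes, so \<open>\<Phi>\<close> has three
  known distinct critical values. They determine \<open>u\<^sub>0\<close>, \<open>c\<close>, \<open>r\<close> up to finitely many
  possibilities, so these are algebraic; the cubic equations then give \<open>V\<close> and \<open>U\<close>.
\<close>

section \<open>Ring homomorphisms and polynomial relations\<close>

locale unital_hom =
  fixes h :: "'a::comm_ring_1 \<Rightarrow> 'b::comm_ring_1"
  assumes hom_1: "h 1 = 1" and hom_add: "h (x + y) = h x + h y" and hom_mult: "h (x * y) = h x * h y"
begin

lemma hom_0: "h 0 = 0"
  using hom_add[of 0 0] by simp

lemma hom_uminus: "h (- x) = - h x"
  using hom_add[of x "- x"] by (simp add: hom_0 eq_neg_iff_add_eq_0 add.commute)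

lemma hom_diff: "h (x - y) = h x - h y"
  using hom_add[of x "- y"] by (simp add: hom_uminus)

lemma hom_power: "h (x ^ n) = h x ^ n"
  by (induction n) (simp_all add: hom_1 hom_mult)

lemma hom_of_nat: "h (of_nat n) = of_nat n"
  by (induction n) (simp_all add: hom_0 hom_1 hom_add)

lemma hom_numeral: "h (numeral k) = numeral k"
  using hom_of_nat[of "numeral k"] by simp

lemma hom_sum: "h (sum f A) = (\<Sum>a\<in>A. h (f a))"
  by (induction A rule: infinite_finite_induct) (simp_all add: hom_0 hom_add)

lemmas homs = hom_0 hom_1 hom_add hom_mult hom_uminus hom_diff hom_power hom_numeral

end

lemma unital_hom_comp: "unital_hom f \<Longrightarrow> unital_hom g \<Longrightarrow> unital_hom (\<lambda>x. f (g x))"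
  by (simp add: unital_hom_def)

lemma (in unital_hom) poly_map_poly: "poly (map_poly h p) (h x) = h (poly p x)"
  by (induction p) (simp_all add: map_poly_pCons homs)

text \<open>Coefficients in the image of the injective \<open>f\<close> have unique preimages, so
  the relation pulls back coefficient by coefficient.\<close>

lemma hom_preimage_of_relation:
  assumes f: "unital_hom f" "inj f" and p: "p \<noteq> 0" "\<And>i. Polynomial.coeff p i \<in> f ` A" "poly p (f x) = 0"
  shows "\<exists>q. q \<noteq> 0 \<and> (\<forall>i. Polynomial.coeff q i \<in> A) \<and> poly q x = 0"
proof -
  interpret unital_hom f by fact
  have inv: "the_inv f (f a) = a" for a using f(2) by (simp add: the_inv_f_f)
  have inv0: "the_inv f 0 = 0" using inv[of 0] by (simp add: homs)
  define q where "q = map_poly (the_inv f) p"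
  have q: "f (Polynomial.coeff q i) = Polynomial.coeff p i \<and> Polynomial.coeff q i \<in> A" for i
    using p(2)[of i] by (auto simp: q_def coeff_map_poly inv0 inv)
  have "map_poly f q = p"
    by (rule poly_eqI) (use q in \<open>simp add: coeff_map_poly homs\<close>)
  then have "f (poly q x) = 0" "q \<noteq> 0"
    using poly_map_poly[of q x] p(1,3) by (auto simp: homs)
  then have "poly q x = 0"
    using injD[OF f(2), of "poly q x" 0] by (simp add: homs)
  then show ?thesis using q \<open>q \<noteq> 0\<close> by blast
qed

lemma to_fract_power: "to_fract (x ^ n) = to_fract x ^ n"
  by (induction n) simp_all

lemma to_fract_numeral: "to_fract (numeral k) = numeral k"
proof -
  have "to_fract (of_nat n) = of_nat n" for n
    by (induction n) simp_all
  from this[of "numeral k"] show ?thesis by simp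
qed

text \<open>Characteristic zero enters through the discriminant argument, which divides by 2, 3 and
  27 and relies on an integer leading coefficient being nonzero.\<close>

instance fract :: ("{idom, semiring_char_0}") field_char_0
proof
  show "inj (of_nat :: nat \<Rightarrow> 'a fract)"
    by (rule injI) (simp add: of_nat_fract eq_fract)
qed

section \<open>Algebraic elements over a subfield\<close>

text \<open>The record form of a field type: its subfields become plain sets, to which the degree
  arguments for finite extensions apply.\<close>

abbreviation type_ring :: "'a::field ring" where
  "type_ring \<equiv> ring_of_type_algebra"

lemma type_ring_simps [simp]:
  "carrier type_ring = UNIV" "mult type_ring = (*)" "one type_ring = 1"
  "zero type_ring = 0" "add type_ring = (+)"
  by (simp_all add: ring_of_type_algebra_def fun_eq_iff)

lemma type_ring_pow [simp]: "x [^]\<^bsub>type_ring\<^esub> (n::nat) = (x::'a::field) ^ n"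
proof -
  interpret Ring.field "type_ring :: 'a ring" by (rule field_from_type_algebra)
  show ?thesis by (induction n) (simp_all add: mult.commute)
qed

lemma
  fixes x :: "'a::field"
  shows type_ring_uminus: "\<ominus>\<^bsub>type_ring\<^esub> x = - x"
    and type_ring_inverse: "x \<noteq> 0 \<Longrightarrow> inv\<^bsub>type_ring\<^esub> x = inverse x"
proof -
  interpret Ring.field "type_ring :: 'a ring" by (rule field_from_type_algebra)
  show "\<ominus>\<^bsub>type_ring\<^esub> x = - x"
    by (rule minus_equality) simp_all
  show "inv\<^bsub>type_ring\<^esub> x = inverse x" if "x \<noteq> 0"
    by (rule comm_inv_char) (use that in simp_all)
qed

text \<open>Polynomials over the record are lists with the leading coefficient first, hence the
  reversal.\<close>

lemma eval_type_ring:
  "ring.eval type_ring xs (x::'a::field) = poly (Poly (rev xs)) x"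
proof -
  interpret Ring.field "type_ring :: 'a ring" by (rule field_from_type_algebra)
  show ?thesis
    by (induction xs) (simp_all add: Poly_append poly_monom)
qed

lemma set_coeffsE:
  assumes "y \<in> set (coeffs p)"
  obtains i where "y = Polynomial.coeff p i"
  using assms range_coeff[of p] by (metis imageE insertCI)

lemma algebraic_over_iff:
  assumes "subfield K (type_ring :: 'a::field ring)"
  shows "algebraic_over K x \<longleftrightarrow> (ring.algebraic type_ring over K) (x :: 'a)"
proof -
  interpret Ring.field "type_ring :: 'a ring" by (rule field_from_type_algebra)
  have K: "subring K type_ring" and K0: "0 \<in> K"
    using assms subfieldE(1) subringE(2) by fastforce+
  show ?thesis
  proof
    assume "algebraic_over K x"
    then obtain p where p: "p \<noteq> 0" "\<forall>i. Polynomial.coeff p i \<in> K" "poly p x = 0"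
      by (auto simp: algebraic_over_def)
    have "rev (coeffs p) \<in> carrier (K[X]\<^bsub>type_ring\<^esub>)"
      using p(1,2)
      by (auto simp: univ_poly_def polynomial_def hd_rev last_coeffs_eq_coeff_degree elim!: set_coeffsE)
    then show "(algebraic over K) x"
      using p by (intro algebraicI[of "rev (coeffs p)"]) (auto simp: eval_type_ring)
  next
    assume "(algebraic over K) x"
    then obtain xs where xs: "xs \<in> carrier (K[X]\<^bsub>type_ring\<^esub>)" "xs \<noteq> []" "eval xs x = \<zero>\<^bsub>type_ring\<^esub>"
      using algebraicE[OF K] by auto
    let ?p = "Poly (rev xs)"
    have sub: "set xs \<subseteq> K" and hd: "hd xs \<noteq> 0"
      using xs(1,2) by (auto simp: univ_poly_def polynomial_def)
    have "Polynomial.coeff ?p (length xs - 1) = hd xs"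
      using xs(2) by (simp add: coeff_Poly_eq nth_default_def rev_nth hd_conv_nth)
    then have "?p \<noteq> 0" using hd by (metis Polynomial.coeff_0)
    moreover have "Polynomial.coeff ?p i \<in> K" for i
      using sub K0 by (auto simp: coeff_Poly_eq nth_default_def rev_nth)
    ultimately show "algebraic_over K x"
      using xs(3) unfolding algebraic_over_def
      by (intro exI[of _ ?p]) (auto simp: eval_type_ring)
  qed
qed

lemma subfield_algebraic_over:
  assumes "subfield K (type_ring :: 'a::field ring)"
  shows "subfield {x. algebraic_over K x} (type_ring :: 'a ring)"
proof -
  interpret Ring.field "type_ring :: 'a ring" by (rule field_from_type_algebra)
  show ?thesis
    using subfield_of_algebraics[OF assms] by (simp add: algebraic_over_iff[OF assms])
qed

text \<open>The coefficients of \<open>p\<close> generate a finite extension of \<open>K\<close>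
  over which \<open>x\<close> is algebraic; by the tower law, adjoining \<open>x\<close> as well
  keeps the degree over \<open>K\<close> finite.\<close>

lemma algebraic_over_trans:
  assumes K: "subfield K (type_ring :: 'a::field ring)"
    and p: "p \<noteq> 0" "\<And>i. algebraic_over K (Polynomial.coeff p i)" "poly p x = 0"
  shows "algebraic_over K (x :: 'a)"
proof -
  interpret Ring.field "type_ring :: 'a ring" by (rule field_from_type_algebra)
  let ?L = "finite_extension K (coeffs p)"
  have alg: "(algebraic over K) y" if "y \<in> set (coeffs p)" for y
    using that p(2) by (auto simp: algebraic_over_iff[OF K, symmetric] elim!: set_coeffsE)
  have L: "subfield ?L type_ring"
    by (rule finite_extension_is_subfield[OF K]) (use alg in auto)
  have finL: "finite_dimension K ?L"
    by (rule finite_extension_finite_dimension[OF K]) (use alg in auto)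
  have L0: "0 \<in> ?L"
    using L subfieldE(1) subringE(2) by fastforce
  have "Polynomial.coeff p i \<in> ?L" for i
  proof (cases "i \<le> Polynomial.degree p")
    case True
    then have "Polynomial.coeff p i \<in> set (coeffs p)"
      using p(1) by (simp add: coeff_in_coeffs)
    then show ?thesis
      using finite_extension_mem[OF subfieldE(1)[OF K], of "coeffs p"] by auto
  qed (use L0 in \<open>simp add: coeff_eq_0\<close>)
  then have "algebraic_over ?L x"
    unfolding algebraic_over_def using p by blast
  then have x: "(algebraic over ?L) x"
    using algebraic_over_iff[OF L] by blast
  have "finite_dimension ?L (simple_extension ?L x)"
    using finite_dimension_simple_extension[OF L] x by simp
  then have "finite_dimension K (simple_extension ?L x)"
    by (rule telescopic_base_dim(1)[OF K L finL])
  then have "(algebraic over K) x"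
    using finite_dimension_imp_algebraic[OF K simple_extension_is_subring[OF subfieldE(1)[OF L]]]
      simple_extension_mem[OF subfieldE(1)[OF L]] by simp
  then show ?thesis
    using algebraic_over_iff[OF K] by blast
qed

lemma subfield_type_ringI:
  fixes K :: "'a::field set"
  assumes "1 \<in> K" "\<And>x y. x \<in> K \<Longrightarrow> y \<in> K \<Longrightarrow> x - y \<in> K"
    "\<And>x y. x \<in> K \<Longrightarrow> y \<in> K \<Longrightarrow> x * y \<in> K" "\<And>x. x \<in> K \<Longrightarrow> inverse x \<in> K"
  shows "subfield K type_ring"
proof -
  interpret Ring.field "type_ring :: 'a ring" by (rule field_from_type_algebra)
  have 0: "0 \<in> K" using assms(1) assms(2)[of 1 1] by simp
  have neg: "- x \<in> K" if "x \<in> K" for x using assms(2)[OF 0 that] by simp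
  have add: "x + y \<in> K" if "x \<in> K" "y \<in> K" for x y using assms(2)[OF that(1) neg[OF that(2)]] by simp
  show ?thesis
    by (rule subfieldI'[OF subringI]) (use assms add neg in \<open>auto simp: type_ring_uminus type_ring_inverse\<close>)
qed

lemma
  fixes K :: "'a::field set"
  assumes "subfield K type_ring"
  shows subfield_type_ring_0: "0 \<in> K" and subfield_type_ring_1: "1 \<in> K"
    and subfield_type_ring_add: "\<And>x y. x \<in> K \<Longrightarrow> y \<in> K \<Longrightarrow> x + y \<in> K"
    and subfield_type_ring_mult: "\<And>x y. x \<in> K \<Longrightarrow> y \<in> K \<Longrightarrow> x * y \<in> K"
    and subfield_type_ring_uminus: "\<And>x. x \<in> K \<Longrightarrow> - x \<in> K"
    and subfield_type_ring_inverse: "\<And>x. x \<in> K \<Longrightarrow> inverse x \<in> K"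
proof -
  interpret Ring.field "type_ring :: 'a ring" by (rule field_from_type_algebra)
  note K = subringE[OF subfieldE(1)[OF assms]]
  show 0: "0 \<in> K" and "1 \<in> K" using K(2,3) by auto
  show "x + y \<in> K" if "x \<in> K" "y \<in> K" for x y using K(7)[OF that] by simp
  show "x * y \<in> K" if "x \<in> K" "y \<in> K" for x y using K(6)[OF that] by simp
  show "- x \<in> K" if "x \<in> K" for x using K(5)[OF that] by (simp add: type_ring_uminus)
  show "inverse x \<in> K" if "x \<in> K" for x
    using subfield_m_inv(1)[OF assms, of x] that 0 type_ring_inverse[of x] by (cases "x = 0") auto
qed

section \<open>Subrings and their fraction fields\<close>

definition subring_set :: "'a::comm_ring_1 set \<Rightarrow> bool" where
  "subring_set S \<longleftrightarrow> 1 \<in> S \<and> (\<forall>x\<in>S. \<forall>y\<in>S. x - y \<in> S \<and> x * y \<in> S)"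

definition fracs :: "'a::idom set \<Rightarrow> 'a fract set" where
  "fracs S = {Fract p q | p q. p \<in> S \<and> q \<in> S \<and> q \<noteq> 0}"

lemma subring_setD:
  assumes "subring_set S"
  shows "0 \<in> S" "1 \<in> S" "\<And>x y. x \<in> S \<Longrightarrow> y \<in> S \<Longrightarrow> x - y \<in> S"
    "\<And>x y. x \<in> S \<Longrightarrow> y \<in> S \<Longrightarrow> x + y \<in> S" "\<And>x y. x \<in> S \<Longrightarrow> y \<in> S \<Longrightarrow> x * y \<in> S"
proof -
  show 1: "1 \<in> S" and diff: "\<And>x y. x \<in> S \<Longrightarrow> y \<in> S \<Longrightarrow> x - y \<in> S"
    and "\<And>x y. x \<in> S \<Longrightarrow> y \<in> S \<Longrightarrow> x * y \<in> S"
    using assms by (auto simp: subring_set_def)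
  show 0: "0 \<in> S" using diff[OF 1 1] by simp
  show "x + y \<in> S" if "x \<in> S" "y \<in> S" for x y
    using diff[OF that(1) diff[OF 0 that(2)]] by simp
qed

lemma subfield_fracs:
  assumes "subring_set S"
  shows "subfield (fracs S) type_ring"
proof (rule subfield_type_ringI)
  note S = subring_setD[OF assms]
  show "1 \<in> fracs S"
    using S by (auto simp: fracs_def One_fract_def intro!: exI[of _ 1])
  fix x y assume "x \<in> fracs S" "y \<in> fracs S"
  then obtain a b c d where x: "x = Fract a b" "a \<in> S" "b \<in> S" "b \<noteq> 0"
    and y: "y = Fract c d" "c \<in> S" "d \<in> S" "d \<noteq> 0"
    by (auto simp: fracs_def)
  have "x - y = Fract (a * d - c * b) (b * d)" "x * y = Fract (a * c) (b * d)"
    using x y by simp_all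
  then show "x - y \<in> fracs S" "x * y \<in> fracs S"
    using x y S unfolding fracs_def by (metis (mono_tags, lifting) mem_Collect_eq no_zero_divisors)+
  have "inverse x \<in> fracs S"
  proof (cases "a = 0")
    case True
    then have "inverse x = Fract 0 1"
      using x by (simp add: Zero_fract_def[symmetric] fract_collapse)
    then show ?thesis using S(1,2) unfolding fracs_def by fastforce
  next
    case False
    then show ?thesis using x by (auto simp: fracs_def)
  qed
  then show "inverse x \<in> fracs S" .
qed

lemma to_fract_in_fracs: "subring_set S \<Longrightarrow> x \<in> S \<Longrightarrow> to_fract x \<in> fracs S"
  unfolding fracs_def to_fract_def using subring_setD(2) by fastforce

lemma fracs_common_denominator:
  fixes n :: nat
  assumes S: "subring_set S" and f: "\<And>i. f i \<in> fracs S"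
  shows "\<exists>d\<in>S. d \<noteq> 0 \<and> (\<forall>i<n. to_fract d * f i \<in> to_fract ` S)"
proof (induction n)
  case 0
  then show ?case using subring_setD(2)[OF S] by (intro bexI[of _ 1]) auto
next
  case (Suc n)
  then obtain d where d: "d \<in> S" "d \<noteq> 0" "\<And>i. i < n \<Longrightarrow> to_fract d * f i \<in> to_fract ` S"
    by auto
  obtain p q where pq: "f n = Fract p q" "p \<in> S" "q \<in> S" "q \<noteq> 0"
    using f[of n] by (auto simp: fracs_def)
  have "to_fract (d * q) * f i \<in> to_fract ` S" if i: "i < Suc n" for i
  proof (cases "i = n")
    case True
    have "to_fract (d * q) * f n = to_fract (d * p)"
      using pq by (simp add: to_fract_def eq_fract)
    then show ?thesis using True subring_setD(5)[OF S d(1) pq(2)] by blast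
  next
    case False
    then obtain s where s: "s \<in> S" "to_fract d * f i = to_fract s"
      using d(3)[of i] i by (auto simp: less_Suc_eq)
    have "to_fract (d * q) * f i = to_fract (q * s)"
      using s(2) by (simp add: mult_ac)
    then show ?thesis using subring_setD(5)[OF S pq(3) s(1)] by blast
  qed
  then show ?case
    using d(1,2) pq subring_setD(5)[OF S] by (intro bexI[of _ "d * q"]) auto
qed

lemma unital_hom_to_fract: "unital_hom to_fract"
  by unfold_locales simp_all

lemma inj_to_fract: "inj to_fract"
  by (rule injI) simp

text \<open>A common denominator of the coefficients turns a relation over the fraction field into
  one over \<open>S\<close>. In that form it can be moved along homomorphisms defined on series
  only.\<close>

lemma algebraic_over_fracs_iff:
  assumes S: "subring_set S"
  shows "algebraic_over (fracs S) (to_fract x) \<longleftrightarrow>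
    (\<exists>p. p \<noteq> 0 \<and> (\<forall>i. Polynomial.coeff p i \<in> S) \<and> poly p x = 0)"
proof
  assume "\<exists>p. p \<noteq> 0 \<and> (\<forall>i. Polynomial.coeff p i \<in> S) \<and> poly p x = 0"
  then obtain p where p: "p \<noteq> 0" "\<And>i. Polynomial.coeff p i \<in> S" "poly p x = 0"
    by auto
  have "Polynomial.coeff (fract_poly p) i \<in> fracs S" for i
    using to_fract_in_fracs[OF S p(2)[of i]] by (simp add: coeff_map_poly)
  then show "algebraic_over (fracs S) (to_fract x)"
    using p unital_hom.poly_map_poly[OF unital_hom_to_fract, of p x] unfolding algebraic_over_def
    by (intro exI[of _ "fract_poly p"]) auto
next
  assume "algebraic_over (fracs S) (to_fract x)"
  then obtain p where p: "p \<noteq> 0" "\<And>i. Polynomial.coeff p i \<in> fracs S" "poly p (to_fract x) = 0"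
    by (auto simp: algebraic_over_def)
  obtain d where d: "d \<in> S" "d \<noteq> 0"
    "\<And>i. i < Suc (Polynomial.degree p) \<Longrightarrow> to_fract d * Polynomial.coeff p i \<in> to_fract ` S"
    using fracs_common_denominator[OF S, of "Polynomial.coeff p", OF p(2)] by metis
  define r where "r = Polynomial.smult (to_fract d) p"
  have r: "Polynomial.coeff r i \<in> to_fract ` S" for i
  proof (cases "i \<le> Polynomial.degree p")
    case False
    then have "Polynomial.coeff r i = to_fract 0" by (simp add: r_def coeff_eq_0)
    then show ?thesis using subring_setD(1)[OF S] by blast
  qed (use d(3) in \<open>simp add: r_def\<close>)
  have "r \<noteq> 0" "poly r (to_fract x) = 0" using p d(2) by (auto simp: r_def)
  then show "\<exists>p. p \<noteq> 0 \<and> (\<forall>i. Polynomial.coeff p i \<in> S) \<and> poly p x = 0"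
    using hom_preimage_of_relation[OF unital_hom_to_fract inj_to_fract _ r] by blast
qed

lemma algebraic_over_in:
  assumes "subfield K (type_ring :: 'a::field ring)" "x \<in> K"
  shows "algebraic_over K x"
  unfolding algebraic_over_def
  using assms subfield_type_ring_0[OF assms(1)] subfield_type_ring_1[OF assms(1)] subfield_type_ring_uminus[OF assms(1)]
  by (intro exI[of _ "[:- x, 1:]"]) (auto simp: coeff_pCons split: nat.splits)

section \<open>Closure properties of algebraic elements\<close>

context
  fixes K :: "'a::field set"
  assumes K: "subfield K type_ring"
begin

lemmas algebraics = subfield_algebraic_over[OF K]

lemma
  shows algebraic_over_0: "algebraic_over K 0" and algebraic_over_1: "algebraic_over K 1"
    and algebraic_over_add: "algebraic_over K x \<Longrightarrow> algebraic_over K y \<Longrightarrow> algebraic_over K (x + y)"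
    and algebraic_over_mult: "algebraic_over K x \<Longrightarrow> algebraic_over K y \<Longrightarrow> algebraic_over K (x * y)"
    and algebraic_over_uminus: "algebraic_over K x \<Longrightarrow> algebraic_over K (- x)"
    and algebraic_over_inverse: "algebraic_over K x \<Longrightarrow> algebraic_over K (inverse x)"
  using subfield_type_ring_0[OF algebraics] subfield_type_ring_1[OF algebraics]
    subfield_type_ring_add[OF algebraics, of x y] subfield_type_ring_mult[OF algebraics, of x y]
    subfield_type_ring_uminus[OF algebraics, of x] subfield_type_ring_inverse[OF algebraics, of x]
  by auto

lemma algebraic_over_diff:
  "algebraic_over K x \<Longrightarrow> algebraic_over K y \<Longrightarrow> algebraic_over K (x - y)"
  using algebraic_over_add[of x "- y"] algebraic_over_uminus by simp

lemma algebraic_over_divide: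
  "algebraic_over K x \<Longrightarrow> algebraic_over K y \<Longrightarrow> algebraic_over K (x / y)"
  using algebraic_over_mult[of x "inverse y"] algebraic_over_inverse by (simp add: field_simps)

lemma algebraic_over_power: "algebraic_over K x \<Longrightarrow> algebraic_over K (x ^ n)"
  by (induction n) (auto intro: algebraic_over_1 algebraic_over_mult)

lemma algebraic_over_of_nat: "algebraic_over K (of_nat n)"
  by (induction n) (auto intro: algebraic_over_0 algebraic_over_1 algebraic_over_add)

lemma algebraic_over_numeral: "algebraic_over K (numeral n)"
  using algebraic_over_of_nat[of "numeral n"] by simp

lemmas algebraic_over_intros = algebraic_over_0 algebraic_over_1 algebraic_over_numeral
  algebraic_over_add algebraic_over_diff algebraic_over_uminus algebraic_over_mult
  algebraic_over_divide algebraic_over_power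

lemma algebraic_over_root:
  assumes "p \<noteq> 0" "\<forall>c\<in>set (coeffs p). algebraic_over K c" "poly p x = 0"
  shows "algebraic_over K x"
proof (rule algebraic_over_trans[OF K assms(1) _ assms(3)])
  show "algebraic_over K (Polynomial.coeff p i)" for i
    using assms(2) range_coeff[of p] algebraic_over_0 by (metis insert_iff rangeI)
qed

text \<open>\<open>x\<close> is a root of \<open>Z^n - x^n\<close>.\<close>

lemma algebraic_over_power_imp:
  assumes "algebraic_over K (x ^ n)" "n > 0"
  shows "algebraic_over K x"
proof (rule algebraic_over_trans[OF K])
  show "Polynomial.monom 1 n - [:x ^ n:] \<noteq> 0"
    using assms(2) by (auto simp: poly_eq_iff coeff_pCons intro!: exI[of _ n] split: nat.splits)
  show "algebraic_over K (Polynomial.coeff (Polynomial.monom 1 n - [:x ^ n:]) i)" for i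
    using assms by (auto simp: coeff_pCons algebraic_over_intros split: nat.splits)
qed (simp add: poly_monom)

end

section \<open>Cubics with prescribed critical values\<close>

lemma quadratic_zero_if_three_roots:
  fixes a b c :: "'a::field"
  assumes "a * x^2 + b * x + c = 0" "a * y^2 + b * y + c = 0" "a * z^2 + b * z + c = 0"
    and "x \<noteq> y" "x \<noteq> z" "y \<noteq> z"
  shows "a = 0 \<and> b = 0 \<and> c = 0"
proof -
  have eq: "(s - t) * (a * (s + t) + b) = (a * s^2 + b * s + c) - (a * t^2 + b * t + c)" for s t
    by (simp add: algebra_simps power2_eq_square)
  have "a * (x + y) + b = 0" "a * (x + z) + b = 0"
    using eq[of x y] eq[of x z] assms by simp_all
  moreover from this have "(a * (x + y) + b) - (a * (x + z) + b) = 0" by simp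
  then have "(y - z) * a = 0" by (simp add: algebra_simps)
  ultimately show ?thesis using assms by auto
qed

text \<open>The discriminant of the depressed cubic \<open>z\<^sup>3 + (p - e) z + (a e + b)\<close> is a cubic
  polynomial in \<open>e\<close> with leading coefficient \<open>4\<close>, so its roots determine its coefficients.
  Eliminating \<open>p\<close> and \<open>b\<close> leaves a nonzero polynomial equation for \<open>a\<close>.\<close>

lemma algebraic_over_discriminant:
  fixes K :: "'a::field_char_0 set"
  assumes K: "subfield K type_ring"
    and e: "algebraic_over K x" "algebraic_over K y" "algebraic_over K z" "x \<noteq> y" "x \<noteq> z" "y \<noteq> z"
    and disc: "\<And>e. e \<in> {x, y, z} \<Longrightarrow> 4 * (p - e)^3 + 27 * (a * e + b)^2 = 0"
  shows "algebraic_over K a \<and> algebraic_over K p \<and> algebraic_over K b"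
proof -
  define s1 s2 s3 where "s1 = x + y + z" and "s2 = x * y + x * z + y * z" and "s3 = x * y * z"
  note alg = algebraic_over_intros[OF K]
  have s: "algebraic_over K s1" "algebraic_over K s2" "algebraic_over K s3"
    unfolding s1_def s2_def s3_def by (intro alg e)+
  \<comment> \<open>Adding \<open>4 * (e - x) * (e - y) * (e - z)\<close> removes the term
    \<open>-4 * e^3\<close> of the discriminant expression. What remains is a quadratic in
    \<open>e\<close> with three distinct roots, so its coefficients vanish.\<close>
  have "(12*p + 27*a^2 - 4*s1) * e^2 + (54*a*b - 12*p^2 + 4*s2) * e + (4*p^3 + 27*b^2 - 4*s3) = 0"
    if "e \<in> {x, y, z}" for e
  proof -
    have "(e - x) * (e - y) * (e - z) = 0" using that by auto
    moreover have "(12*p + 27*a^2 - 4*s1) * e^2 + (54*a*b - 12*p^2 + 4*s2) * e + (4*p^3 + 27*b^2 - 4*s3) =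
        (4 * (p - e)^3 + 27 * (a * e + b)^2) + 4 * ((e - x) * (e - y) * (e - z))"
      unfolding s1_def s2_def s3_def by (simp add: algebra_simps power2_eq_square power3_eq_cube)
    ultimately show ?thesis using disc[OF that] by simp
  qed
  then have "12*p + 27*a^2 - 4*s1 = 0 \<and> 54*a*b - 12*p^2 + 4*s2 = 0 \<and> 4*p^3 + 27*b^2 - 4*s3 = 0"
    using e by (intro quadratic_zero_if_three_roots[of _ x _ _ y z]) auto
  then have 1: "12*p + 27*a^2 - 4*s1 = 0" and 2: "54*a*b - 12*p^2 + 4*s2 = 0"
    and 3: "4*p^3 + 27*b^2 - 4*s3 = 0"
    by auto
  define c where "c = s1 / 3"
  have c: "algebraic_over K c" unfolding c_def by (intro alg s)
  \<comment> \<open>Both \<open>p\<close> and the equation obtained by eliminating \<open>b\<close>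
    depend on \<open>a\<close> only through its square.\<close>
  define d where "d = a^2 / 4"
  have a: "a^2 = 4 * d" by (simp add: d_def)
  have p: "p = c - 9 * d"
  proof -
    have "12 * p = 12 * (c - 9 * d)"
      using 1 by (simp add: c_def a algebra_simps)
    then show ?thesis using mult_left_cancel[of 12 p "c - 9 * d"] by auto
  qed
  \<comment> \<open>Squaring the second relation produces \<open>a^2 * b^2\<close>, and the third
    expresses \<open>b^2\<close> through \<open>p\<close>; the constants match because
    \<open>54^2 = 108 * 27\<close>.\<close>
  have elim: "(12*p^2 - 4*s2)^2 - 1728 * d * (s3 - p^3) = 0"
  proof -
    have "12*p^2 - 4*s2 = 54*a*b" "4 * (s3 - p^3) = 27*b^2"
      using 2 3 by (simp_all add: algebra_simps)
    then have "(12*p^2 - 4*s2)^2 - 108 * a^2 * (4 * (s3 - p^3)) = (54*a*b)^2 - 108 * a^2 * (27*b^2)"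
      by simp
    then show ?thesis by (simp add: power_mult_distrib a)
  qed
  \<comment> \<open>A quartic in \<open>d\<close> whose leading coefficient \<open>-314928\<close>
    is a nonzero number, so the equation is nontrivial for all values of the symmetric
    functions.\<close>
  have expand: "(12*(c - 9*d)^2 - 4*s2)^2 - 1728 * d * (s3 - (c - 9*d)^3) =
      (144*c^4 - 96*s2*c^2 + 16*s2^2) + d * ((-3456*c^3 + 1728*c*s2 - 1728*s3)
      + d * ((23328*c^2 - 7776*s2) + d * (d * (-314928))))"
    by (simp add: algebra_simps power2_eq_square power3_eq_cube power4_eq_xxxx)
  have d: "algebraic_over K d"
  proof (rule algebraic_over_root[OF K])
    show "poly [:144*c^4 - 96*s2*c^2 + 16*s2^2, -3456*c^3 + 1728*c*s2 - 1728*s3,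
      23328*c^2 - 7776*s2, 0, -314928:] d = 0" (is "poly ?q d = 0")
      using elim[unfolded p expand] by simp
    show "?q \<noteq> 0" by simp
    have "algebraic_over K (-314928)" "algebraic_over K (144*c^4 - 96*s2*c^2 + 16*s2^2)"
      "algebraic_over K (-3456*c^3 + 1728*c*s2 - 1728*s3)" "algebraic_over K (23328*c^2 - 7776*s2)"
      by (intro alg c s)+
    then show "\<forall>d\<in>set (coeffs ?q). algebraic_over K d"
      using alg(1) by (auto simp: cCons_def)
  qed
  then have "algebraic_over K (a^2)"
    unfolding a by (intro alg)
  then have "algebraic_over K a"
    by (rule algebraic_over_power_imp[OF K]) simp
  moreover have p': "algebraic_over K p" unfolding p by (intro alg c d)
  moreover have "algebraic_over K (b^2)"
  proof -
    have "b^2 = (4*s3 - 4*p^3) / 27" using 3 by (simp add: field_simps)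
    then show ?thesis by (simp only:) (intro alg s p')
  qed
  then have "algebraic_over K b"
    by (rule algebraic_over_power_imp[OF K]) simp
  ultimately show ?thesis by blast
qed

text \<open>For each \<open>k\<close> the cubic \<open>(v^2 + l * v + c - e k) * (v - u) - r\<close>
  in \<open>v\<close> has the double root \<open>v k\<close>, so its discriminant vanishes at three
  distinct values of \<open>e\<close>. The discriminant lemma applies after depressing the
  cubic.\<close>

lemma algebraic_over_double_roots:
  fixes K :: "'a::field_char_0 set" and e v :: "nat \<Rightarrow> 'a"
  assumes K: "subfield K type_ring" and l: "algebraic_over K l"
    and e: "\<And>k. k < 3 \<Longrightarrow> algebraic_over K (e k)" "inj_on e {..<3}"
    and root: "\<And>k. k < 3 \<Longrightarrow> ((v k)^2 + l * v k + c - e k) * (v k - u) = r"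
    and deriv: "\<And>k. k < 3 \<Longrightarrow> (2 * v k + l) * (v k - u) + ((v k)^2 + l * v k + c - e k) = 0"
  shows "algebraic_over K u \<and> algebraic_over K c \<and> algebraic_over K r"
proof -
  \<comment> \<open>The shift \<open>z = v + m\<close> removes the quadratic term;
    \<open>p - e\<close> and \<open>a * e + b\<close> are then the remaining coefficients.\<close>
  define m where "m = (l - u) / 3"
  have l_eq: "l = 3 * m + u" by (simp add: m_def field_simps)
  define p where "p = c - l * u - 3 * m^2"
  define a where "a = m + u"
  define b where "b = 2 * m^3 - m * (c - l * u) - u * c - r"
  note alg = algebraic_over_intros[OF K]
  have disc: "4 * (p - e k)^3 + 27 * (a * e k + b)^2 = 0" if k: "k < 3" for k
  proof -
    define z where "z = v k + m"
    have v: "v k = z - m" by (simp add: z_def)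
    have "z^3 + (p - e k) * z + (a * e k + b) = ((v k)^2 + l * v k + c - e k) * (v k - u) - r"
      unfolding v p_def a_def b_def l_eq
      by (simp add: algebra_simps power2_eq_square power3_eq_cube)
    then have 1: "z^3 + (p - e k) * z + (a * e k + b) = 0"
      using root[OF k] by simp
    have "3 * z^2 + (p - e k) = (2 * v k + l) * (v k - u) + ((v k)^2 + l * v k + c - e k)"
      unfolding v p_def l_eq by (simp add: algebra_simps power2_eq_square)
    \<comment> \<open>A double root \<open>z\<close> of a depressed cubic fixes its coefficients as
      \<open>-3 * z^2\<close> and \<open>2 * z^3\<close>, which annihilate the discriminant.\<close>
    then have 2: "p - e k = - 3 * z^2"
      using deriv[OF k] by (simp add: add_eq_0_iff)
    have "a * e k + b = (z^3 + (p - e k) * z + (a * e k + b)) - z^3 - (p - e k) * z"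
      by simp
    also have "\<dots> = - (z^3) - (p - e k) * z"
      using 1 by simp
    finally have "a * e k + b = - (z^3) - (p - e k) * z" .
    then have 3: "a * e k + b = 2 * z^3"
      unfolding 2 by (simp add: power2_eq_square power3_eq_cube)
    show ?thesis unfolding 2 3 by (simp add: power_mult_distrib flip: power_mult)
  qed
  have "e 0 \<noteq> e 1" "e 0 \<noteq> e 2" "e 1 \<noteq> e 2"
    using inj_onD[OF e(2), of 0 1] inj_onD[OF e(2), of 0 2] inj_onD[OF e(2), of 1 2] by auto
  then have *: "algebraic_over K a \<and> algebraic_over K p \<and> algebraic_over K b"
    using disc[of 0] disc[of 1] disc[of 2] e(1)[of 0] e(1)[of 1] e(1)[of 2]
    by (intro algebraic_over_discriminant[OF K, of "e 0" "e 1" "e 2"]) auto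
  have "u = (3 * a - l) / 2" by (simp add: a_def l_eq field_simps)
  then have u: "algebraic_over K u"
    by (simp only:) (intro alg l conjunct1[OF *])
  have m: "algebraic_over K m" unfolding m_def by (intro alg l u)
  have "c = p + l * u + 3 * m^2" by (simp add: p_def)
  then have c: "algebraic_over K c"
    by (simp only:) (intro alg l u m conjunct1[OF conjunct2[OF *]])
  have "r = 2 * m^3 - m * (c - l * u) - u * c - b" by (simp add: b_def)
  then have "algebraic_over K r"
    by (simp only:) (intro alg l u c m conjunct2[OF conjunct2[OF *]])
  then show ?thesis using u c by blast
qed

text \<open>The factored shape fits the cubic equations of both specializations; expanded, the
  leading coefficient is \<open>a\<close> up to sign.\<close>

lemma algebraic_over_cubic:
  fixes K :: "'a::field set"
  assumes K: "subfield K type_ring"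
    and alg: "algebraic_over K a" "algebraic_over K b" "algebraic_over K c" "algebraic_over K d" "algebraic_over K e"
    and "a \<noteq> 0" and eq: "(b - a * x^2 - c * x) * (x - d) = e"
  shows "algebraic_over K x"
proof (rule algebraic_over_root[OF K])
  let ?p = "[:b * d + e, - b - c * d, c - a * d, a:]"
  show "?p \<noteq> 0" using \<open>a \<noteq> 0\<close> by simp
  show "poly ?p x = 0"
    unfolding eq[symmetric] by (simp add: algebra_simps power2_eq_square)
  have "algebraic_over K (b * d + e)" "algebraic_over K (- b - c * d)" "algebraic_over K (c - a * d)"
    by (intro algebraic_over_intros[OF K] alg)+
  then show "\<forall>c\<in>set (coeffs ?p). algebraic_over K c"
    using alg(1) by (auto simp: cCons_def)
qed

section \<open>Power series maps\<close>

definition fps_map :: "('a \<Rightarrow> 'b) \<Rightarrow> 'a fps \<Rightarrow> 'b fps" where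
  "fps_map f F = Abs_fps (\<lambda>n. f (F $ n))"

lemma fps_map_nth [simp]: "fps_map f F $ n = f (F $ n)"
  by (simp add: fps_map_def)

lemma unital_hom_fps_map:
  assumes "unital_hom f"
  shows "unital_hom (fps_map f)"
proof -
  interpret unital_hom f by fact
  show ?thesis
    by unfold_locales (simp_all add: fps_eq_iff fps_mult_nth homs hom_sum)
qed

lemma (in unital_hom) fps_map_fps_X: "fps_map h fps_X = fps_X"
  by (simp add: fps_eq_iff fps_X_def homs)

lemma (in unital_hom) fps_map_fps_const: "fps_map h (fps_const c) = fps_const (h c)"
  by (simp add: fps_eq_iff homs)

lemma unital_hom_fps_const: "unital_hom fps_const"
  by unfold_locales (simp_all flip: fps_const_1_eq_1)

lemma unital_hom_nth_0: "unital_hom (\<lambda>g. g $ 0)"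
  by unfold_locales simp_all

text \<open>Substitution of \<open>T\<close> for the outer variable, where the coefficients are
  already series in the variable of \<open>T\<close>. If \<open>T\<close> has no constant term,
  \<open>T ^ n\<close> has order at least \<open>n\<close>, so only \<open>n \<le> m\<close>
  contributes to coefficient \<open>m\<close>.\<close>

definition fps_eval :: "'a::comm_ring_1 fps \<Rightarrow> 'a fps fps \<Rightarrow> 'a fps" where
  "fps_eval T F = Abs_fps (\<lambda>m. \<Sum>n\<le>m. (F $ n * T ^ n) $ m)"

lemma mult_power_nth_eq_0:
  fixes A T :: "'a::comm_ring_1 fps"
  assumes "T $ 0 = 0" "m < n"
  shows "(A * T ^ n) $ m = 0"
  using startsby_zero_power_prefix[OF assms(1), of n] assms(2)
  by (simp add: fps_mult_nth)

lemma fps_eval_nth: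
  assumes "T $ 0 = 0" "m \<le> N"
  shows "fps_eval T F $ m = (\<Sum>n\<le>N. F $ n * T ^ n) $ m"
proof -
  have "(\<Sum>n\<le>N. (F $ n * T ^ n) $ m) = (\<Sum>n\<le>m. (F $ n * T ^ n) $ m)"
    by (rule sum.mono_neutral_right) (use assms in \<open>auto simp: mult_power_nth_eq_0\<close>)
  then show ?thesis by (simp add: fps_eval_def fps_sum_nth)
qed

lemma fps_eval_mult:
  assumes T: "T $ 0 = 0"
  shows "fps_eval T (F * G) = fps_eval T F * fps_eval T G"
proof (rule fps_ext)
  fix m
  have "(fps_eval T F * fps_eval T G) $ m = (\<Sum>i=0..m. fps_eval T F $ i * fps_eval T G $ (m - i))"
    by (rule fps_mult_nth)
  \<comment> \<open>All truncations may be taken at the common bound \<open>m\<close>.\<close>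
  also have "\<dots> = (\<Sum>i=0..m. (\<Sum>n\<le>m. F $ n * T ^ n) $ i * (\<Sum>n\<le>m. G $ n * T ^ n) $ (m - i))"
    by (rule sum.cong) (auto simp: fps_eval_nth[OF T, of _ m])
  also have "\<dots> = ((\<Sum>n\<le>m. F $ n * T ^ n) * (\<Sum>n\<le>m. G $ n * T ^ n)) $ m"
    by (rule fps_mult_nth[symmetric])
  also have "\<dots> = (\<Sum>(n, k)\<in>{..m} \<times> {..m}. (F $ n * G $ k * T ^ (n + k)) $ m)"
    by (simp add: sum_product sum.cartesian_product fps_sum_nth power_add mult_ac case_prod_unfold)
  \<comment> \<open>The square of index pairs shrinks to the triangle, since the other products have
    order above \<open>m\<close>.\<close>
  also have "\<dots> = (\<Sum>(n, k)\<in>{(n, k). n + k \<le> m}. (F $ n * G $ k * T ^ (n + k)) $ m)"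
  proof (rule sum.mono_neutral_right)
    have "(F $ n * G $ k * T ^ (n + k)) $ m = 0" if "m < n + k" for n k
      using mult_power_nth_eq_0[OF T that] .
    then show "\<forall>p\<in>{..m} \<times> {..m} - {(n, k). n + k \<le> m}.
        (case p of (n, k) \<Rightarrow> (F $ n * G $ k * T ^ (n + k)) $ m) = 0"
      by (simp add: split_paired_all not_le)
  qed auto
  also have "\<dots> = (\<Sum>l\<le>m. \<Sum>n\<le>l. (F $ n * G $ (l - n) * T ^ (n + (l - n))) $ m)"
    by (rule sum.triangle_reindex_eq)
  also have "\<dots> = (\<Sum>l\<le>m. ((F * G) $ l * T ^ l) $ m)"
    by (rule sum.cong) (simp_all add: fps_mult_nth[of F G] sum_distrib_right fps_sum_nth atMost_atLeast0)
  finally show "fps_eval T (F * G) $ m = (fps_eval T F * fps_eval T G) $ m"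
    by (simp add: fps_eval_def)
qed

lemma fps_eval_fps_const: "fps_eval T (fps_const c) = c"
proof (rule fps_ext)
  fix m
  have "(\<Sum>n\<le>m. (fps_const c $ n * T ^ n) $ m) = (\<Sum>n\<in>{0}. (fps_const c $ n * T ^ n) $ m)"
    by (rule sum.mono_neutral_right) auto
  then show "fps_eval T (fps_const c) $ m = c $ m"
    by (simp add: fps_eval_def)
qed

lemma unital_hom_fps_eval:
  assumes "T $ 0 = 0"
  shows "unital_hom (fps_eval T)"
proof
  show "fps_eval T 1 = 1"
    using fps_eval_fps_const[of T 1] by simp
  show "fps_eval T (F + G) = fps_eval T F + fps_eval T G" for F G
    by (simp add: fps_eq_iff fps_eval_def distrib_right sum.distrib)
qed (rule fps_eval_mult[OF assms])

lemma unital_hom_fps_compose: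
  assumes "b $ 0 = 0"
  shows "unital_hom (\<lambda>a::'a::field fps. a oo b)"
  by unfold_locales (simp_all add: fps_compose_add_distrib fps_compose_mult_distrib assms)

text \<open>The polynomials with coefficients in \<open>A\<close>, kept inside the power series
  ring; iterating three times gives the polynomials in \<open>X\<close>, \<open>Y\<close>,
  \<open>t\<close>.\<close>

definition finite_series :: "'a::comm_ring_1 set \<Rightarrow> 'a fps set" where
  "finite_series A = {F. (\<forall>n. F $ n \<in> A) \<and> (\<exists>N. \<forall>n\<ge>N. F $ n = 0)}"

lemma sum_in_subring_set: "subring_set A \<Longrightarrow> (\<And>i. i \<in> I \<Longrightarrow> f i \<in> A) \<Longrightarrow> sum f I \<in> A"
  by (induction I rule: infinite_finite_induct) (auto intro: subring_setD)

lemma subring_set_finite_series: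
  assumes A: "subring_set A"
  shows "subring_set (finite_series A)"
  unfolding subring_set_def
proof (intro conjI ballI)
  show "1 \<in> finite_series A"
    using subring_setD(1,2)[OF A] by (auto simp: finite_series_def intro!: exI[of _ 1])
  fix F G assume "F \<in> finite_series A" "G \<in> finite_series A"
  then obtain M N where F: "\<And>n. F $ n \<in> A" "\<And>n. n \<ge> M \<Longrightarrow> F $ n = 0"
    and G: "\<And>n. G $ n \<in> A" "\<And>n. n \<ge> N \<Longrightarrow> G $ n = 0"
    unfolding finite_series_def by auto
  show "F - G \<in> finite_series A"
    using F G subring_setD(3)[OF A] by (auto simp: finite_series_def intro!: exI[of _ "max M N"])
  have "(F * G) $ n = 0" if "n \<ge> M + N" for n
    unfolding fps_mult_nth
  proof (rule sum.neutral, rule ballI)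
    fix i assume "i \<in> {0..n}"
    with that have "i \<ge> M \<or> n - i \<ge> N" by auto
    then show "F $ i * G $ (n - i) = 0" using F(2) G(2) by auto
  qed
  moreover have "(F * G) $ n \<in> A" for n
    unfolding fps_mult_nth using F(1) G(1) subring_setD(5)[OF A] by (intro sum_in_subring_set[OF A]) auto
  ultimately show "F * G \<in> finite_series A"
    by (auto simp: finite_series_def)
qed

lemma subring_set_UNIV: "subring_set UNIV"
  by (simp add: subring_set_def)

lemma fps_const_in_finite_series: "subring_set A \<Longrightarrow> c \<in> A \<Longrightarrow> fps_const c \<in> finite_series A"
  using subring_setD(1) by (auto simp: finite_series_def intro!: exI[of _ 1])

lemma fps_X_in_finite_series: "subring_set A \<Longrightarrow> fps_X \<in> finite_series A"
  using subring_setD(1,2) by (auto simp: finite_series_def fps_X_def intro!: exI[of _ 2])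

section \<open>The functional equation\<close>

definition walks_to :: "(int \<times> int) set \<Rightarrow> nat \<Rightarrow> int \<times> int \<Rightarrow> (int \<times> int) list set" where
  "walks_to S n p = {P. P \<in> quadrant_walks S n \<and> P ! 0 = (0, 0) \<and> P ! n = p}"

text \<open>End points are integer pairs so that the recursion on the last step may refer to points
  outside the quadrant, where the sum is zero.\<close>

definition walk_sum ::
  "(int \<times> int) set \<Rightarrow> (int \<times> int \<Rightarrow> complex) \<Rightarrow> nat \<Rightarrow> int \<times> int \<Rightarrow> complex" where
  "walk_sum S w n p = (\<Sum>P\<in>walks_to S n p. walk_weight w P)"

lemma walk_coeff_eq_walk_sum: "walk_coeff S w i j n = walk_sum S w n (int i, int j)"
  by (simp add: walk_coeff_def walk_sum_def walks_to_def)

lemma finite_walks_to: "finite S \<Longrightarrow> finite (walks_to S n p)"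
  by (rule finite_subset[OF _ finite_quadrant_walks_from[of S n "(0, 0)"]]) (auto simp: walks_to_def)

lemma walk_sum_outside: "\<not> (0 \<le> fst p \<and> 0 \<le> snd p) \<Longrightarrow> walk_sum S w n p = 0"
proof -
  assume "\<not> (0 \<le> fst p \<and> 0 \<le> snd p)"
  then have "walks_to S n p = {}" by (auto simp: walks_to_def quadrant_walks_def)
  then show ?thesis by (simp add: walk_sum_def)
qed

lemma walk_sum_0: "walk_sum S w 0 p = (if p = (0, 0) then 1 else 0)"
proof -
  have "walks_to S 0 p = (if p = (0, 0) then {[(0, 0)]} else {})"
    by (auto simp: walks_to_def quadrant_walks_def length_Suc_conv)
  then show ?thesis by (simp add: walk_sum_def walk_weight_def)
qed

lemma walks_to_Suc:
  assumes "0 \<le> fst p" "0 \<le> snd p"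
  shows "walks_to S (Suc n) p = (\<Union>s\<in>S. (\<lambda>P. P @ [p]) ` walks_to S n (p - s))"
proof (intro equalityI subsetI)
  fix P assume P: "P \<in> walks_to S (Suc n) p"
  then have len: "length P = n + 2"
    by (simp add: walks_to_def quadrant_walks_def)
  obtain s where s: "s \<in> S" "P ! (n + 1) = P ! n + s"
    using P by (auto simp: walks_to_def quadrant_walks_def)
  have "take (n + 1) P \<in> walks_to S n (p - s)"
    using P len s(2) by (auto simp: walks_to_def quadrant_walks_def)
  moreover have "P = take (n + 1) P @ [p]"
    using len P take_Suc_conv_app_nth[of "n + 1" P] by (simp add: walks_to_def)
  ultimately show "P \<in> (\<Union>s\<in>S. (\<lambda>P. P @ [p]) ` walks_to S n (p - s))"
    using s(1) by blast
next
  fix P assume "P \<in> (\<Union>s\<in>S. (\<lambda>P. P @ [p]) ` walks_to S n (p - s))"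
  then obtain s R where s: "s \<in> S" and R: "R \<in> walks_to S n (p - s)" and P: "P = R @ [p]"
    by auto
  have len: "length R = Suc n" and R0: "R ! 0 = (0, 0)" and Rn: "R ! n = p - s"
    and pos: "\<And>k. k \<le> n \<Longrightarrow> 0 \<le> fst (R ! k) \<and> 0 \<le> snd (R ! k)"
    and step: "\<And>k. k < n \<Longrightarrow> \<exists>s\<in>S. R ! (k + 1) = R ! k + s"
    using R by (auto simp: walks_to_def quadrant_walks_def)
  have "0 \<le> fst (P ! k) \<and> 0 \<le> snd (P ! k)" if "k \<le> Suc n" for k
    using that pos[of k] assms len by (auto simp: P nth_append)
  moreover have "\<exists>s\<in>S. P ! (k + 1) = P ! k + s" if "k < Suc n" for k
    using that step[of k] s len Rn by (cases "k = n") (auto simp: P nth_append)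
  ultimately show "P \<in> walks_to S (Suc n) p"
    using len R0 by (auto simp: walks_to_def quadrant_walks_def P nth_append)
qed

lemma walk_weight_snoc:
  assumes "P \<in> walks_to S n q"
  shows "walk_weight w (P @ [p]) = walk_weight w P * w (p - q)"
proof -
  have len: "length P = Suc n" and n: "P ! n = q"
    using assms by (auto simp: walks_to_def quadrant_walks_def)
  have "(\<Prod>k<n. w ((P @ [p]) ! (k + 1) - (P @ [p]) ! k)) = (\<Prod>k<n. w (P ! (k + 1) - P ! k))"
    by (rule prod.cong) (use len in \<open>auto simp: nth_append\<close>)
  then show ?thesis
    using len n by (simp add: walk_weight_def nth_append)
qed

lemma walk_sum_Suc:
  assumes "finite S" "0 \<le> fst p" "0 \<le> snd p"
  shows "walk_sum S w (Suc n) p = (\<Sum>s\<in>S. w s * walk_sum S w n (p - s))"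
proof -
  have disj: "(\<lambda>P. P @ [p]) ` walks_to S n (p - s) \<inter> (\<lambda>P. P @ [p]) ` walks_to S n (p - s') = {}"
    if "s \<noteq> s'" for s s'
    using that by (auto simp: walks_to_def)
  have "walk_sum S w (Suc n) p =
      (\<Sum>s\<in>S. \<Sum>P\<in>(\<lambda>P. P @ [p]) ` walks_to S n (p - s). walk_weight w P)"
    unfolding walk_sum_def walks_to_Suc[OF assms(2,3)]
    by (rule sum.UNION_disjoint) (use assms(1) finite_walks_to disj in auto)
  also have "\<dots> = (\<Sum>s\<in>S. w s * walk_sum S w n (p - s))"
  proof (rule sum.cong[OF refl])
    fix s assume "s \<in> S"
    have "(\<Sum>P\<in>(\<lambda>P. P @ [p]) ` walks_to S n (p - s). walk_weight w P) =
        (\<Sum>P\<in>walks_to S n (p - s). walk_weight w (P @ [p]))"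
      by (rule sum.reindex_cong[of "\<lambda>P. P @ [p]"]) (auto simp: inj_on_def)
    also have "\<dots> = (\<Sum>P\<in>walks_to S n (p - s). w s * walk_weight w P)"
      by (rule sum.cong) (simp_all add: walk_weight_snoc mult.commute)
    finally show "(\<Sum>P\<in>(\<lambda>P. P @ [p]) ` walks_to S n (p - s). walk_weight w P) =
        w s * walk_sum S w n (p - s)"
      by (simp add: walk_sum_def sum_distrib_left)
  qed
  finally show ?thesis .
qed

abbreviation G_sum :: "complex \<Rightarrow> nat \<Rightarrow> int \<Rightarrow> int \<Rightarrow> complex" where
  "G_sum l n i j \<equiv> walk_sum G_steps (G_weight l) n (i, j)"

lemma G_sum_Suc:
  assumes "0 \<le> i" "0 \<le> j"
  shows "G_sum l (Suc n) i j = G_sum l n (i + 1) (j + 1) + G_sum l n i (j - 1)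
    + l * G_sum l n (i - 1) j + G_sum l n (i - 2) (j - 1) + G_sum l n (i - 1) (j + 1)"
proof -
  have "finite G_steps" by (simp add: G_steps_def)
  from walk_sum_Suc[OF this, of "(i, j)" "G_weight l" n] show ?thesis
    using assms by (simp add: G_steps_def G_weight_def)
qed

section \<open>Generating series and kernel\<close>

definition xvar :: series3 where "xvar = fps_const (fps_const fps_X)"
definition yvar :: series3 where "yvar = fps_const fps_X"
abbreviation tvar :: series3 where "tvar \<equiv> fps_X"
definition const3 :: "complex \<Rightarrow> series3" where
  "const3 c = fps_const (fps_const (fps_const c))"

lemma xvar_mult_nth: "(xvar * F) $ n $ j $ i = (if i = 0 then 0 else F $ n $ j $ (i - 1))"
  by (simp add: xvar_def)

lemma yvar_mult_nth: "(yvar * F) $ n $ j $ i = (if j = 0 then 0 else F $ n $ (j - 1) $ i)"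
  by (simp add: yvar_def)

lemma tvar_mult_nth: "(tvar * F) $ n $ j $ i = (if n = 0 then 0 else F $ (n - 1) $ j $ i)"
  for F :: series3
  by simp

lemma const3_mult_nth: "(const3 c * F) $ n $ j $ i = c * F $ n $ j $ i"
  by (simp add: const3_def)

definition G_series :: "complex \<Rightarrow> series3" where
  "G_series l = walk_series G_steps (G_weight l)"

lemma G_series_nth: "G_series l $ n $ j $ i = G_sum l n (int i) (int j)"
  by (simp add: G_series_def walk_series_def walk_coeff_eq_walk_sum)

text \<open>This is \<open>x y (1 - t S(x, y))\<close>, where \<open>S\<close> is the weighted step
  polynomial with its negative exponents.\<close>

definition walk_kernel :: "complex \<Rightarrow> series3" where
  "walk_kernel l = xvar * yvar - tvar * ((1 + xvar^2) * (xvar * yvar^2 + 1) + const3 l * xvar^2 * yvar)"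

lemma fps3_eqI: "(\<And>n j i. F $ n $ j $ i = G $ n $ j $ i) \<Longrightarrow> F = G" for F G :: series3
  by (simp add: fps_eq_iff)

lemma subst_Y0_nth: "subst_Y0 F $ n $ j $ i = (if j = 0 then F $ n $ 0 $ i else 0)"
  by (simp add: subst_Y0_def)

lemma subst_X0_nth: "subst_X0 F $ n $ j $ i = (if i = 0 then F $ n $ j $ 0 else 0)"
  by (simp add: subst_X0_def)

lemma one3_nth: "(1 :: series3) $ n $ j $ i = (if n = 0 \<and> j = 0 \<and> i = 0 then 1 else 0)"
  by simp

lemma G_sum_outside: "i < 0 \<or> j < 0 \<Longrightarrow> G_sum l n i j = 0"
  by (rule walk_sum_outside) auto

text \<open>Appending a step must not leave the quadrant. From the row \<open>j = 0\<close> the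
  steps \<open>(-1, -1)\<close> and \<open>(1, -1)\<close> are excluded, and from the rest of the
  column \<open>i = 0\<close> the step \<open>(-1, -1)\<close>; these give the subtracted boundary
  terms.\<close>

lemma functional_equation:
  fixes l
  defines "Q \<equiv> G_series l"
  shows "walk_kernel l * Q = xvar * yvar - tvar * (1 + xvar^2) * subst_Y0 Q
    - tvar * (subst_X0 Q - subst_X0 (subst_Y0 Q))"
proof -
  note nths = xvar_mult_nth yvar_mult_nth tvar_mult_nth const3_mult_nth one3_nth Q_def
    subst_Y0_nth subst_X0_nth
  \<comment> \<open>Only products with a single variable or constant occur, so each coefficient is
    read off by shifting indices.\<close>
  have "xvar * (yvar * Q) = tvar * (xvar * (yvar * (yvar * Q)) + Q
      + xvar * (xvar * (xvar * (yvar * (yvar * Q)))) + xvar * (xvar * Q)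
      + const3 l * (xvar * (xvar * (yvar * Q))))
    + xvar * (yvar * 1) - tvar * (subst_Y0 Q + xvar * (xvar * subst_Y0 Q))
    - tvar * (subst_X0 Q - subst_X0 (subst_Y0 Q))" (is "?L = ?R")
  proof (rule fps3_eqI)
    fix n j i
    show "?L $ n $ j $ i = ?R $ n $ j $ i"
    proof (cases n)
      case 0
      then show ?thesis
        by (simp only: fps_add_nth fps_sub_nth nths) (auto simp: G_series_nth walk_sum_0)
    next
      case (Suc m)
      consider "i = 0" | i' where "i = Suc i'" "j = 0" | i' j' where "i = Suc i'" "j = Suc j'"
        by (cases i; cases j) auto
      then show ?thesis
      proof cases
        case 1
        then show ?thesis using Suc by (simp only: fps_add_nth fps_sub_nth nths) simp
      next
        case 2
        then show ?thesis using Suc by (simp only: fps_add_nth fps_sub_nth nths) simp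
      next
        case 3
        have sub: "int (a - 1) = int a - 1" if "a \<noteq> 0" for a
          using that by simp
        \<comment> \<open>Because of the factor \<open>x y\<close>, the recursion is applied at the
          end point \<open>(i - 1, j - 1)\<close>.\<close>
        have "G_sum l (Suc m) (int i') (int j') = G_sum l m (int i) (int j) + G_sum l m (int i - 1) (int j - 2)
          + l * G_sum l m (int i - 2) (int j - 1) + G_sum l m (int i - 3) (int j - 2) + G_sum l m (int i - 2) (int j)"
          using G_sum_Suc[of "int i'" "int j'" l m] 3 by (simp add: algebra_simps)
        then show ?thesis using Suc 3
          by (simp only: fps_add_nth fps_sub_nth nths)
            (auto simp: G_series_nth sub G_sum_outside algebra_simps)
      qed
    qed
  qed
  then show ?thesis
    unfolding walk_kernel_def by (simp add: algebra_simps power2_eq_square)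
qed

section \<open>Separation of variables modulo the kernel\<close>

lemmas unital_hom_const_nth_0 = unital_hom_comp[OF unital_hom_fps_const unital_hom_nth_0]

lemma subst_Y0_eq: "subst_Y0 = fps_map (\<lambda>g. fps_const (g $ 0))"
  by (simp add: fun_eq_iff subst_Y0_def fps_map_def)

lemma subst_X0_eq: "subst_X0 = fps_map (fps_map (\<lambda>h. fps_const (h $ 0)))"
  by (simp add: fun_eq_iff subst_X0_def fps_map_def)

interpretation subst_Y0: unital_hom subst_Y0
  unfolding subst_Y0_eq by (intro unital_hom_fps_map unital_hom_const_nth_0)

interpretation subst_X0: unital_hom subst_X0
  unfolding subst_X0_eq by (intro unital_hom_fps_map unital_hom_const_nth_0)

lemma subst_vars [simp]:
  "subst_Y0 xvar = xvar" "subst_Y0 yvar = 0" "subst_Y0 tvar = tvar" "subst_Y0 (const3 c) = const3 c"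
  "subst_X0 xvar = 0" "subst_X0 yvar = yvar" "subst_X0 tvar = tvar" "subst_X0 (const3 c) = const3 c"
  by (auto intro!: fps3_eqI simp: subst_Y0_nth subst_X0_nth xvar_def yvar_def const3_def)

lemmas subst_simps [simp] = subst_Y0.homs subst_X0.homs

lemma subst_idem [simp]:
  "subst_Y0 (subst_Y0 F) = subst_Y0 F" "subst_X0 (subst_X0 F) = subst_X0 F"
  "subst_Y0 (subst_X0 F) = subst_X0 (subst_Y0 F)"
  by (auto intro!: fps3_eqI simp: subst_Y0_nth subst_X0_nth)

lemma split_off_xvar:
  assumes "subst_Y0 F = F"
  obtains G where "subst_Y0 G = G" "F = subst_X0 F + xvar * G"
proof
  let ?G = "Abs_fps (\<lambda>n. Abs_fps (\<lambda>j. Abs_fps (\<lambda>i. F $ n $ j $ Suc i)))"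
  have "F $ n $ j $ i = 0" if "j \<noteq> 0" for n j i
    using arg_cong[OF assms, of "\<lambda>F. F $ n $ j $ i"] that by (simp add: subst_Y0_nth)
  then show "subst_Y0 ?G = ?G"
    by (auto intro!: fps3_eqI simp: subst_Y0_nth)
  show "F = subst_X0 F + xvar * ?G"
    by (rule fps3_eqI) (auto simp: subst_X0_nth xvar_mult_nth)
qed

lemma split_off_yvar:
  assumes "subst_X0 F = F"
  obtains G where "subst_X0 G = G" "F = subst_Y0 F + yvar * G"
proof
  let ?G = "Abs_fps (\<lambda>n. Abs_fps (\<lambda>j. F $ n $ Suc j))"
  have "F $ n $ j $ i = 0" if "i \<noteq> 0" for n j i
    using arg_cong[OF assms, of "\<lambda>F. F $ n $ j $ i"] that by (simp add: subst_X0_nth)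
  then show "subst_X0 ?G = ?G"
    by (auto intro!: fps3_eqI simp: subst_X0_nth)
  show "F = subst_Y0 F + yvar * ?G"
    by (rule fps3_eqI) (auto simp: subst_Y0_nth yvar_mult_nth)
qed

definition kernel_tail :: "complex \<Rightarrow> complex fps fps" where
  "kernel_tail l = (1 + fps_const fps_X^2) * (fps_const fps_X * fps_X^2 + 1)
     + fps_const (fps_const l) * fps_const fps_X^2 * fps_X"

lemma kernel_eq: "walk_kernel l = xvar * yvar - tvar * fps_const (kernel_tail l)"
proof -
  interpret unital_hom "fps_const :: complex fps fps \<Rightarrow> series3" by (rule unital_hom_fps_const)
  show ?thesis
    by (simp only: walk_kernel_def kernel_tail_def xvar_def yvar_def const3_def homs)
qed

text \<open>Inversion goes one variable at a time: the constant term in \<open>y\<close> is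
  \<open>1 + x^2\<close>, itself a unit in \<open>x\<close>.\<close>

lemma kernel_tail_unit: "\<exists>g. fps_const (kernel_tail l) * g = 1"
proof -
  have "kernel_tail l $ 0 * fps_right_inverse (kernel_tail l $ 0) 1 = 1"
    by (rule fps_right_inverse) (simp add: kernel_tail_def)
  from fps_right_inverse[OF this] show ?thesis
    by (metis fps_const_1_eq_1 fps_const_mult)
qed

lemma kernel_mult_nth:
  "(walk_kernel l * H) $ n = fps_const fps_X * fps_X * H $ n - (if n = 0 then 0 else kernel_tail l * H $ (n - 1))"
  by (simp add: kernel_eq xvar_def yvar_def left_diff_distrib mult.assoc flip: fps_const_mult)

text \<open>\<open>F - G\<close> has no monomial containing both \<open>x\<close> and
  \<open>y\<close>. If the quotient \<open>H\<close> vanishes below order \<open>n\<close> in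
  \<open>t\<close>, then the order \<open>n\<close> part of the product is \<open>x y\<close> times
  that of \<open>H\<close>, all of whose monomials are mixed; hence \<open>H = 0\<close> by
  induction.\<close>

lemma kernel_dvd_separated:
  assumes "walk_kernel l dvd F - G" and F: "subst_Y0 F = F" and G: "subst_X0 G = G"
  shows "F = G"
proof -
  obtain H where H: "F - G = walk_kernel l * H" using assms(1) by (elim dvdE)
  have F0: "F $ n $ Suc j $ i = 0" for n j i
    using arg_cong[OF F, of "\<lambda>F. F $ n $ Suc j $ i"] by (simp add: subst_Y0_nth)
  have G0: "G $ n $ j $ Suc i = 0" for n j i
    using arg_cong[OF G, of "\<lambda>F. F $ n $ j $ Suc i"] by (simp add: subst_X0_nth)
  have "H $ n = 0" for n
  proof (induction n)
    case 0
    have "H $ 0 $ j $ i = (walk_kernel l * H) $ 0 $ Suc j $ Suc i" for i j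
      by (simp add: kernel_mult_nth mult.assoc del: fps_mult_nth_0)
    then show ?case by (simp add: fps_eq_iff F0 G0 flip: H)
  next
    case (Suc n)
    have "H $ Suc n $ j $ i = (walk_kernel l * H) $ Suc n $ Suc j $ Suc i" for i j
      using Suc by (simp add: kernel_mult_nth mult.assoc)
    then show ?case by (simp add: fps_eq_iff F0 G0 flip: H)
  qed
  then have "H = 0" by (simp add: fps_eq_iff)
  then show ?thesis using H by simp
qed

text \<open>Modulo the kernel \<open>x y\<close> equals \<open>t\<close> times a unit, so it
  suffices to cancel \<open>t\<close>.\<close>

lemma kernel_dvd_cancel_xy:
  assumes "walk_kernel l dvd xvar * yvar * Z"
  shows "walk_kernel l dvd Z"
proof -
  define k where "k = fps_const (kernel_tail l)"
  obtain g where g: "k * g = 1" unfolding k_def using kernel_tail_unit by blast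
  have "walk_kernel l dvd xvar * yvar * Z - walk_kernel l * Z"
    using assms by (rule dvd_diff) simp
  then have "walk_kernel l dvd (xvar * yvar * Z - walk_kernel l * Z) * g"
    by (rule dvd_mult2)
  also have "(xvar * yvar * Z - walk_kernel l * Z) * g = tvar * Z * (k * g)"
    unfolding kernel_eq k_def[symmetric] by (simp only: algebra_simps)
  finally have "walk_kernel l dvd tvar * Z" unfolding g by simp
  then obtain H where H: "tvar * Z = walk_kernel l * H" by (elim dvdE)
  \<comment> \<open>At \<open>t = 0\<close> the kernel is \<open>x y\<close>, so \<open>H\<close>
    vanishes there and is divisible by \<open>t\<close>.\<close>
  have "fps_const fps_X * fps_X * H $ 0 = (tvar * Z) $ 0"
    unfolding H kernel_mult_nth by simp
  then have "H $ 0 = 0" by simp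
  then have shift: "H = tvar * fps_shift 1 H"
    by (simp add: fps_eq_iff)
  have "tvar * Z = tvar * (walk_kernel l * fps_shift 1 H)"
    unfolding H by (subst shift) (simp only: mult.left_commute)
  then have "Z = walk_kernel l * fps_shift 1 H" by simp
  then show ?thesis by simp
qed

lemma kernel_dvd_cancel_xy_power: "walk_kernel l dvd (xvar * yvar) ^ n * Z \<Longrightarrow> walk_kernel l dvd Z"
proof (induction n)
  case (Suc n)
  from Suc.prems have "walk_kernel l dvd xvar * yvar * ((xvar * yvar) ^ n * Z)"
    by (simp only: power_Suc mult.assoc)
  then show ?case by (rule Suc.IH[OF kernel_dvd_cancel_xy])
qed simp

section \<open>The cubic equations for the two specializations\<close>

text \<open>As a polynomial in \<open>y\<close> the left side is \<open>t^2 a^2 x\<close> times the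
  quartic with \<open>e = I(x)\<close>. The kernel is its quadratic factor with roots
  \<open>y\<close> and \<open>1 / (x y)\<close>; the second factor on the right carries the other
  two roots.\<close>

lemma separated_identity:
  fixes x y t L a :: "'a::comm_ring_1"
  assumes "a = 1 + x^2"
  shows "y^2 * (t^2 * a^2 * (1 - x^2) + x^2 * (x + t * L) * (1 - t * L * x))
      - t * a^2 * x * (t + L * t * y + y^3 - t * y^4) =
    (x * y - t * (a * (x * y^2 + 1) + L * x^2 * y))
      * (- t * a * y^2 + x * (x + t * L) * y + t * a * x)"
  unfolding assms by (simp add: algebra_simps eval_nat_numeral)

text \<open>Multiplied by \<open>t a y\<close>, the functional equation has the inseparable term
  \<open>t a x y^2\<close>; adding the kernel itself cancels it. The result is
  \<open>U(x) = V(y)\<close> modulo the kernel, cleared of denominators.\<close>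

lemma decoupling_identity:
  fixes x y t L a B q Q :: "'a::comm_ring_1"
  assumes "a = 1 + x^2"
    and "(x * y - t * (a * (x * y^2 + 1) + L * x^2 * y)) * Q = x * y - t * a * q - B"
  shows "(x * y - t * (a * (x * y^2 + 1) + L * x^2 * y)) * (t * y * a * Q + 1) =
    y * (x * (1 - L * t * x) - t^2 * a^2 * q) - t * a * (1 + y * B)"
proof -
  have "(x * y - t * (a * (x * y^2 + 1) + L * x^2 * y)) * (t * y * a * Q + 1) =
    t * y * a * ((x * y - t * (a * (x * y^2 + 1) + L * x^2 * y)) * Q)
      + (x * y - t * (a * (x * y^2 + 1) + L * x^2 * y))"
    by (simp add: algebra_simps)
  also have "\<dots> = y * (x * (1 - L * t * x) - t^2 * a^2 * q) - t * a * (1 + y * B)"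
    unfolding assms(2) unfolding assms(1) by (simp add: algebra_simps eval_nat_numeral)
  finally show ?thesis .
qed

text \<open>The cubic combination of \<open>u = t a U(x)\<close>, \<open>v = y V(y)\<close> and the rational invariants
  \<open>i = t\<^sup>2 a\<^sup>2 x I(x)\<close>, \<open>j = t y\<^sup>2 J(y)\<close> that has no pole at \<open>x = 0\<close> or \<open>y = 0\<close>.\<close>

lemma cubic_combination:
  fixes x y t L a u v i j U c K :: "'a::comm_ring_1"
  assumes D: "K dvd y^2 * i - t * a^2 * x * j" and E: "K dvd y * u - t * a * v"
  shows "K dvd y^3 * ((i - x * (u^2 + L * t * a * u + c * t^2 * a^2)) * (u - t * a * U))
    - a^3 * x * t^2 * ((j - t * (v^2 + L * y * v + c * y^2)) * (v - y * U))"
proof -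
  \<comment> \<open>\<open>P\<close>, \<open>P'\<close> are the two forms of the first factor and
    \<open>R\<close>, \<open>R'\<close> those of the second; congruence of the factors gives
    congruence of the products.\<close>
  define P P' R R' where "P = y^2 * (i - x * (u^2 + L * t * a * u + c * t^2 * a^2))"
    and "P' = t * a^2 * x * (j - t * (v^2 + L * y * v + c * y^2))"
    and "R = y * (u - t * a * U)" and "R' = t * a * (v - y * U)"
  have "P - P' = (y^2 * i - t * a^2 * x * j)
      - (y * u - t * a * v) * (x * (y * u + t * a * v + L * t * a * y))"
    unfolding P_def P'_def by (simp add: algebra_simps eval_nat_numeral)
  then have "K dvd P - P'" using D E by simp
  moreover have "R - R' = y * u - t * a * v"
    unfolding R_def R'_def by (simp add: algebra_simps)
  then have "K dvd R - R'" using E by simp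
  ultimately have "K dvd (P - P') * R + P' * (R - R')" by simp
  also have "(P - P') * R + P' * (R - R') = P * R - P' * R'" by (simp add: algebra_simps)
  also have "\<dots> = y^3 * ((i - x * (u^2 + L * t * a * u + c * t^2 * a^2)) * (u - t * a * U))
    - a^3 * x * t^2 * ((j - t * (v^2 + L * y * v + c * y^2)) * (v - y * U))"
    unfolding P_def P'_def R_def R'_def by (simp add: algebra_simps eval_nat_numeral)
  finally show ?thesis .
qed

text \<open>The poles \<open>1 / y^2\<close> and \<open>\<lambda> / y\<close> of \<open>J\<close>
  are cancelled by \<open>V^2 + \<lambda> V\<close>; the choice of \<open>c\<close> then removes the
  remaining constant term.\<close>

lemma pole_cancellation_y:
  fixes y t L b b1 b2 c :: "'a::comm_ring_1"
  assumes "b = b1 + y * b2" "c = - 2 * b1"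
  shows "(t + L * t * y + y^3 - t * y^4) - t * ((1 + y * (y * b))^2 + L * y * (1 + y * (y * b)) + c * y^2)
    = y^3 * (1 - t * y - 2 * t * b2 - t * y * b^2 - L * t * b)"
proof -
  have "(t + L * t * y + y^3 - t * y^4) - t * ((1 + y * (y * b))^2 + L * y * (1 + y * (y * b)) + c * y^2)
    = y^3 * (1 - t * y - t * y * b^2 - L * t * b) - t * y^2 * (2 * b + c)"
    by (simp add: algebra_simps eval_nat_numeral)
  then show ?thesis unfolding assms(2) by (simp add: assms(1) algebra_simps eval_nat_numeral)
qed

text \<open>With \<open>a = 1 + x^2\<close>, the four numerators belong to
  \<open>J = J_num / (t y^2)\<close>, \<open>I = I_num / (t^2 a^2 x)\<close>,
  \<open>U = U_num / (t a)\<close> and \<open>V = V_num / y\<close>.\<close>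

definition J_num :: "complex \<Rightarrow> series3" where
  "J_num l = tvar + const3 l * tvar * yvar + yvar^3 - tvar * yvar^4"

definition I_num :: "complex \<Rightarrow> series3" where
  "I_num l = tvar^2 * (1 + xvar^2)^2 * (1 - xvar^2)
    + xvar^2 * (xvar + tvar * const3 l) * (1 - tvar * const3 l * xvar)"

definition U_num :: "complex \<Rightarrow> series3" where
  "U_num l = xvar * (1 - const3 l * tvar * xvar) - tvar^2 * (1 + xvar^2)^2 * subst_Y0 (G_series l)"

definition V_num :: "complex \<Rightarrow> series3" where
  "V_num l = 1 + yvar * (tvar * (subst_X0 (G_series l) - subst_X0 (subst_Y0 (G_series l))))"

lemma xvar_nonzero: "xvar \<noteq> 0" and yvar_nonzero: "yvar \<noteq> 0"
  by (simp_all add: xvar_def yvar_def)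

lemma one_plus_xvar2_unit: "\<exists>g. (1 + xvar^2) * g = 1 \<and> subst_Y0 g = g"
proof -
  have "(1 + fps_X^2) * inverse (1 + fps_X^2 :: complex fps) = 1"
    by (rule inverse_mult_eq_1') simp
  then have "fps_const (fps_const (1 + fps_X^2)) * fps_const (fps_const (inverse (1 + fps_X^2 :: complex fps)))
      = (1 :: series3)"
    by (metis fps_const_1_eq_1 fps_const_mult)
  moreover have "fps_const (fps_const (1 + fps_X^2)) = 1 + xvar^2"
    by (simp add: xvar_def fps_const_power flip: fps_const_add fps_const_1_eq_1)
  moreover have "subst_Y0 (fps_const (fps_const (inverse (1 + fps_X^2 :: complex fps)))) =
      fps_const (fps_const (inverse (1 + fps_X^2 :: complex fps)))"
    by (auto intro!: fps3_eqI simp: subst_Y0_nth)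
  ultimately show ?thesis by metis
qed

lemma cubic_equations:
  obtains U c r where "U = - tvar * subst_X0 (subst_Y0 (G_series l))" "subst_Y0 U = U" "subst_X0 U = U" "subst_Y0 c = c" "subst_X0 c = c"
    "subst_Y0 r = r" "subst_X0 r = r"
    "(J_num l - tvar * (V_num l^2 + const3 l * yvar * V_num l + c * yvar^2)) * (V_num l - yvar * U)
      = yvar^3 * r"
    "(I_num l - xvar * (U_num l^2 + const3 l * tvar * (1 + xvar^2) * U_num l + c * tvar^2 * (1 + xvar^2)^2))
      * (U_num l - tvar * (1 + xvar^2) * U) = xvar * (1 + xvar^2)^3 * tvar^2 * r"
proof -
  define Q where "Q = G_series l"
  define a where "a = 1 + xvar^2"
  define L where "L = const3 l"
  define q0 where "q0 = subst_X0 (subst_Y0 Q)"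
  \<comment> \<open>The value of \<open>U(x)\<close> at \<open>x = 0\<close>, the
    \<open>u\<^sub>0\<close> of the overview: with it \<open>u - t a U\<close> is divisible by
    \<open>x\<close>.\<close>
  define U where "U = - tvar * q0"
  have q0: "subst_X0 q0 = q0" "subst_Y0 q0 = q0" by (simp_all add: q0_def)
  obtain g where g: "a * g = 1" "subst_Y0 g = g" using one_plus_xvar2_unit unfolding a_def by blast
  have a0: "a \<noteq> 0" using g by auto
  have K: "walk_kernel l = xvar * yvar - tvar * (a * (xvar * yvar^2 + 1) + L * xvar^2 * yvar)"
    by (simp only: walk_kernel_def a_def L_def)
  obtain q1 where q1: "subst_Y0 q1 = q1" "subst_Y0 Q = q0 + xvar * q1"
    using split_off_xvar[of "subst_Y0 Q"] unfolding q0_def by auto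
  obtain p1 where p1: "subst_X0 p1 = p1" "subst_X0 Q = q0 + yvar * p1"
    using split_off_yvar[of "subst_X0 Q"] unfolding q0_def by auto
  define b1 where "b1 = subst_Y0 p1"
  have b1: "subst_Y0 b1 = b1" "subst_X0 b1 = b1"
    using p1(1) by (simp_all add: b1_def flip: subst_idem(3))
  obtain p2 where p2: "subst_X0 p2 = p2" "p1 = b1 + yvar * p2"
    using split_off_yvar[OF p1(1)] unfolding b1_def by auto
  define b where "b = tvar * p1"
  \<comment> \<open>Minus twice the constant term of \<open>b\<close> in \<open>y\<close>, as the
    pole cancellation demands.\<close>
  define c where "c = - 2 * (tvar * b1)"
  have B: "tvar * (subst_X0 Q - subst_X0 (subst_Y0 Q)) = yvar * b"
    by (simp add: b_def p1(2) algebra_simps flip: q0_def)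
  define u v where "u = U_num l" and "v = V_num l"
  have u: "u = xvar * (1 - L * tvar * xvar) - tvar^2 * a^2 * subst_Y0 Q"
    by (simp only: u_def U_num_def Q_def L_def a_def)
  have v: "v = 1 + yvar * (yvar * b)"
    by (simp only: v_def V_num_def B[unfolded Q_def])
  have i: "I_num l = tvar^2 * a^2 * (1 - xvar^2) + xvar^2 * (xvar + tvar * L) * (1 - tvar * L * xvar)"
    by (simp only: I_num_def a_def L_def)
  have j: "J_num l = tvar + L * tvar * yvar + yvar^3 - tvar * yvar^4"
    by (simp only: J_num_def L_def)
  define u1 where "u1 = (1 - L * tvar * xvar) - tvar^2 * a * (xvar * subst_Y0 Q + q1)"
  have u1: "u - tvar * a * U = xvar * u1"
  proof -
    have "u - tvar * a * U = xvar * (1 - L * tvar * xvar)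
        - tvar^2 * a * (a * subst_Y0 Q - q0)"
      unfolding u U_def by (simp add: algebra_simps power2_eq_square)
    also have "a * subst_Y0 Q - q0 = xvar * (xvar * subst_Y0 Q + q1)"
      using q1(2) by (simp add: a_def algebra_simps power2_eq_square)
    finally show ?thesis by (simp add: u1_def algebra_simps)
  qed
  define g1 where "g1 = 1 - tvar * yvar - 2 * tvar * (tvar * p2) - tvar * yvar * b^2 - L * tvar * b"
  have g1: "J_num l - tvar * (v^2 + L * yvar * v + c * yvar^2) = yvar^3 * g1"
    unfolding j v g1_def
    by (rule pole_cancellation_y[of _ "tvar * b1"]) (simp_all add: b_def c_def p2(2) algebra_simps)
  define f where "f = (I_num l - xvar * (u^2 + L * tvar * a * u + c * tvar^2 * a^2)) * u1"
  have D: "walk_kernel l dvd yvar^2 * I_num l - tvar * a^2 * xvar * J_num l"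
    unfolding i j separated_identity[OF a_def] K by simp
  have "walk_kernel l * Q = xvar * yvar - tvar * a * subst_Y0 Q - yvar * b"
    using functional_equation[of l] by (simp only: Q_def a_def B[unfolded Q_def])
  from decoupling_identity[OF a_def this[unfolded K]]
  have E: "walk_kernel l dvd yvar * u - tvar * a * v"
    unfolding u v K by (metis dvd_triv_left)
  from cubic_combination[OF D E, of L c U]
  have "walk_kernel l dvd yvar^3 * (xvar * f) - a^3 * xvar * tvar^2 * (yvar^3 * g1 * (v - yvar * U))"
    unfolding u1 g1 by (simp only: f_def mult.assoc mult.left_commute[of _ xvar])
  \<comment> \<open>The factor \<open>x^2\<close> completes \<open>(x y)^3\<close>, and
    \<open>g^3\<close> inverts \<open>a^3\<close>, leaving a difference of a series in
    \<open>x\<close>, \<open>t\<close> and a series in \<open>y\<close>, \<open>t\<close>.\<close>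
  then have "walk_kernel l dvd
      (yvar^3 * (xvar * f) - a^3 * xvar * tvar^2 * (yvar^3 * g1 * (v - yvar * U))) * (xvar^2 * g^3)"
    by (rule dvd_mult2)
  also have "(yvar^3 * (xvar * f) - a^3 * xvar * tvar^2 * (yvar^3 * g1 * (v - yvar * U))) * (xvar^2 * g^3)
      = (xvar * yvar)^3 * (f * g^3 - (a * g)^3 * tvar^2 * (g1 * (v - yvar * U)))"
    by (simp add: algebra_simps power2_eq_square power3_eq_cube)
  finally have dvd: "walk_kernel l dvd (xvar * yvar)^3 * (f * g^3 - tvar^2 * (g1 * (v - yvar * U)))"
    by (simp add: g)
  define r where "r = g1 * (v - yvar * U)"
  have U: "subst_X0 U = U" "subst_Y0 U = U" by (simp_all add: U_def q0)
  have c: "subst_Y0 c = c" "subst_X0 c = c"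
    by (simp_all add: c_def b1)
  have a: "subst_Y0 a = a" by (simp add: a_def)
  have b: "subst_X0 b = b" by (simp add: b_def p1(1))
  have L: "subst_X0 L = L" "subst_Y0 L = L" by (simp_all add: L_def)
  have "subst_Y0 u = u" "subst_Y0 u1 = u1" "subst_Y0 (I_num l) = I_num l"
    by (simp_all add: u u1_def a L q1(1) i)
  then have f: "subst_Y0 (f * g^3) = f * g^3"
    by (simp add: f_def L a g c)
  have r: "subst_X0 r = r"
    by (simp add: r_def g1_def v b U L p2(1))
  have eq: "f * g^3 = tvar^2 * r"
    by (rule kernel_dvd_separated[OF kernel_dvd_cancel_xy_power[OF dvd[folded r_def]] f])
      (simp add: r)
  \<comment> \<open>\<open>r\<close> is free of \<open>x\<close> by its definition and free of
    \<open>y\<close> by its equality with the other side, so it is a series in \<open>t\<close>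
    alone.\<close>
  have "tvar^2 * subst_Y0 r = tvar^2 * r"
    using f unfolding eq by simp
  then have r': "subst_Y0 r = r" by simp
  have "(J_num l - tvar * (v^2 + L * yvar * v + c * yvar^2)) * (v - yvar * U) = yvar^3 * r"
    unfolding g1 r_def by (simp only: mult.assoc)
  moreover have "(I_num l - xvar * (u^2 + L * tvar * a * u + c * tvar^2 * a^2)) * (u - tvar * a * U)
      = xvar * a^3 * tvar^2 * r"
  proof -
    have "f = (a * g)^3 * f" by (simp add: g)
    also have "\<dots> = a^3 * (f * g^3)" by (simp add: power_mult_distrib)
    finally have "f = a^3 * (tvar^2 * r)" by (simp only: eq)
    then show ?thesis unfolding u1 f_def by (simp add: algebra_simps)
  qed
  ultimately show ?thesis
    using that[of U c r] U_def[unfolded q0_def Q_def] U c r r' unfolding u_def v_def a_def L_def by blast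
qed

section \<open>Substituting a critical point\<close>

text \<open>The substitution \<open>x = 0\<close>, \<open>y = Y(s)\<close>, \<open>t = s^3\<close>
  with values in series in \<open>s\<close>.\<close>

definition eval_Yt :: "complex fps \<Rightarrow> series3 \<Rightarrow> complex fps" where
  "eval_Yt Y F = fps_eval (fps_X ^ 3) (fps_map (\<lambda>g. fps_map (\<lambda>h. h $ 0) g oo Y) F)"

definition embed_t :: "complex fps \<Rightarrow> series3" where
  "embed_t = fps_map (\<lambda>c. fps_const (fps_const c))"

lemma unital_hom_embed_t: "unital_hom embed_t"
  unfolding embed_t_def by (rule unital_hom_fps_map[OF unital_hom_comp[OF unital_hom_fps_const unital_hom_fps_const]])

lemma embed_t_nth: "embed_t c $ n $ j $ i = (if j = 0 \<and> i = 0 then c $ n else 0)"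
  by (simp add: embed_t_def)

lemma tvar_eq_embed_t: "tvar = embed_t fps_X" and const3_eq_embed_t: "const3 c = embed_t (fps_const c)"
  by (auto intro!: fps3_eqI simp: embed_t_nth const3_def)

lemma inj_embed_t: "inj embed_t"
proof (rule injI)
  fix c d assume "embed_t c = embed_t d"
  then have "embed_t c $ n $ 0 $ 0 = embed_t d $ n $ 0 $ 0" for n by simp
  then show "c = d" by (simp add: embed_t_nth fps_eq_iff)
qed

lemma embed_tE:
  assumes "subst_Y0 F = F" "subst_X0 F = F"
  obtains c where "F = embed_t c"
proof
  have zero: "F $ n $ j $ i = 0" if "j \<noteq> 0 \<or> i \<noteq> 0" for n j i
  proof (cases "j = 0")
    case False
    have "F $ n $ j $ i = subst_Y0 F $ n $ j $ i" by (simp only: assms(1))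
    then show ?thesis using False by (simp add: subst_Y0_nth)
  next
    case True
    have "F $ n $ j $ i = subst_X0 F $ n $ j $ i" by (simp only: assms(2))
    then show ?thesis using True that by (simp add: subst_X0_nth)
  qed
  show "F = embed_t (Abs_fps (\<lambda>n. F $ n $ 0 $ 0))"
    by (rule fps3_eqI) (simp add: embed_t_nth zero)
qed

context
  fixes Y :: "complex fps"
  assumes Y0: "Y $ 0 = 0"
begin

lemma unital_hom_eval_Yt: "unital_hom (eval_Yt Y)"
  unfolding eval_Yt_def[abs_def]
  by (intro unital_hom_comp[OF unital_hom_fps_eval] unital_hom_fps_map
      unital_hom_comp[OF unital_hom_fps_compose[OF Y0]] unital_hom_nth_0) simp

lemma eval_Yt_embed_t: "eval_Yt Y (embed_t c) = c oo fps_X ^ 3"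
proof -
  interpret nth0: unital_hom "\<lambda>h::complex fps. h $ 0" by (rule unital_hom_nth_0)
  have "fps_map (\<lambda>g. fps_map (\<lambda>h. h $ 0) g oo Y) (embed_t c) = fps_map fps_const c"
    by (rule fps_ext) (simp add: embed_t_def nth0.fps_map_fps_const)
  then show ?thesis
    unfolding eval_Yt_def by (simp add: fps_eq_iff[of _ "c oo _"] fps_eval_def fps_compose_nth atLeast0AtMost)
qed

lemma eval_Yt_vars:
  "eval_Yt Y tvar = fps_X ^ 3" "eval_Yt Y yvar = Y" "eval_Yt Y (const3 c) = fps_const c"
proof -
  show "eval_Yt Y tvar = fps_X ^ 3"
    unfolding tvar_eq_embed_t eval_Yt_embed_t by (simp add: fps_X_fps_compose_startby0)
  show "eval_Yt Y (const3 c) = fps_const c"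
    unfolding const3_eq_embed_t eval_Yt_embed_t by simp
  interpret nth0: unital_hom "\<lambda>h::complex fps. h $ 0" by (rule unital_hom_nth_0)
  have "fps_map (\<lambda>g. fps_map (\<lambda>h. h $ 0) g oo Y) yvar = fps_const Y"
    by (rule fps_ext)
      (simp add: yvar_def nth0.fps_map_fps_X fps_X_fps_compose_startby0 Y0
        unital_hom.hom_0[OF unital_hom_fps_map[OF unital_hom_nth_0]])
  then show "eval_Yt Y yvar = Y"
    by (simp add: eval_Yt_def fps_eval_fps_const)
qed

end

section \<open>Differentiation with respect to \<open>y\<close>\<close>

definition deriv_Y :: "series3 \<Rightarrow> series3" where
  "deriv_Y = fps_map fps_deriv"

lemma deriv_Y_add: "deriv_Y (F + G) = deriv_Y F + deriv_Y G"
  by (simp add: deriv_Y_def fps_eq_iff)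

lemma deriv_Y_mult: "deriv_Y (F * G) = deriv_Y F * G + F * deriv_Y G"
  by (rule fps_ext) (simp add: deriv_Y_def fps_mult_nth fps_deriv_sum sum.distrib add.commute)

lemma deriv_Y_embed_t: "deriv_Y (embed_t c) = 0"
  by (simp add: deriv_Y_def embed_t_def fps_eq_iff)

lemma deriv_Y_yvar: "deriv_Y yvar = 1"
  by (auto intro!: fps3_eqI simp: deriv_Y_def yvar_def)

lemma deriv_Y_diff: "deriv_Y (F - G) = deriv_Y F - deriv_Y G"
  by (simp add: deriv_Y_def fps_eq_iff)

lemma deriv_Y_consts: "deriv_Y tvar = 0" "deriv_Y (const3 c) = 0"
  unfolding tvar_eq_embed_t const3_eq_embed_t by (rule deriv_Y_embed_t)+

section \<open>Polynomial series and rational functions\<close>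

lemma polynomial_series_iff:
  "polynomial_series F \<longleftrightarrow> F \<in> finite_series (finite_series (finite_series UNIV))"
proof
  assume "polynomial_series F"
  then have fin: "finite {(i, j, n). F $ n $ j $ i \<noteq> 0}" by (simp add: polynomial_series_def)
  define S where "S = {(i, j, n). F $ n $ j $ i \<noteq> 0}"
  have "finite ((\<lambda>(i, j, n). i + j + n) ` S)" using fin by (simp add: S_def)
  then obtain N where "\<And>i j n. (i, j, n) \<in> S \<Longrightarrow> i + j + n \<le> N"
    by (force simp: finite_nat_set_iff_bounded_le)
  then have N: "F $ n $ j $ i = 0" if "i + j + n > N" for i j n
    using that unfolding S_def by (metis (mono_tags, lifting) case_prodI linorder_not_le mem_Collect_eq)
  show "F \<in> finite_series (finite_series (finite_series UNIV))"
    unfolding finite_series_def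
    by (auto simp: fps_eq_iff intro!: exI[of _ "Suc N"] N)
next
  assume F: "F \<in> finite_series (finite_series (finite_series UNIV))"
  obtain N where N: "\<And>n. n \<ge> N \<Longrightarrow> F $ n = 0" using F by (auto simp: finite_series_def)
  have "\<forall>n. \<exists>M. \<forall>j\<ge>M. F $ n $ j = 0" using F by (auto simp: finite_series_def)
  then obtain M where M: "\<And>n j. j \<ge> M n \<Longrightarrow> F $ n $ j = 0" by metis
  have "\<forall>n j. \<exists>L. \<forall>i\<ge>L. F $ n $ j $ i = 0" using F by (auto simp: finite_series_def)
  then obtain L where L: "\<And>n j i. i \<ge> L n j \<Longrightarrow> F $ n $ j $ i = 0" by metis
  have "(i, j, n) \<in> (\<Union>n<N. \<Union>j<M n. \<Union>i<L n j. {(i, j, n)})" if "F $ n $ j $ i \<noteq> 0" for i j n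
  proof -
    have "n < N" using that N[of n] by (cases "n < N") auto
    moreover have "j < M n" using that M[of n j] by (cases "j < M n") auto
    moreover have "i < L n j" using that L[of n j i] by (cases "i < L n j") auto
    ultimately show ?thesis by auto
  qed
  then have "{(i, j, n). F $ n $ j $ i \<noteq> 0} \<subseteq> (\<Union>n<N. \<Union>j<M n. \<Union>i<L n j. {(i, j, n)})"
    by auto
  then show "polynomial_series F"
    unfolding polynomial_series_def by (rule finite_subset) auto
qed

lemma rational_functions_eq: "rational_functions = fracs {F. polynomial_series F}"
  by (simp add: rational_functions_def fracs_def)

lemma subring_set_polynomial_series: "subring_set {F. polynomial_series F}"
  unfolding polynomial_series_iff
  using subring_set_finite_series[OF subring_set_finite_series[OF subring_set_finite_series[OF subring_set_UNIV]]]
  by simp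

lemma subfield_rational_functions: "subfield rational_functions type_ring"
  unfolding rational_functions_eq by (rule subfield_fracs[OF subring_set_polynomial_series])

lemma polynomial_series_embed_t:
  assumes "c \<in> finite_series UNIV"
  shows "polynomial_series (embed_t c)"
proof -
  obtain N where N: "\<And>n. n \<ge> N \<Longrightarrow> c $ n = 0" using assms by (auto simp: finite_series_def)
  have "{(i, j, n). embed_t c $ n $ j $ i \<noteq> 0} \<subseteq> {0} \<times> {0} \<times> {..<N}"
    using N by (auto simp: embed_t_nth split: if_splits) (meson not_le)
  then show ?thesis
    unfolding polynomial_series_def by (rule finite_subset) auto
qed

lemma polynomial_series_vars:
  "polynomial_series xvar" "polynomial_series yvar" "polynomial_series tvar" "polynomial_series (const3 c)"
proof -
  note * = subring_set_finite_series subring_set_UNIV fps_const_in_finite_series fps_X_in_finite_series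
  show "polynomial_series xvar" "polynomial_series yvar" "polynomial_series tvar" "polynomial_series (const3 c)"
    unfolding polynomial_series_iff xvar_def yvar_def const3_def by (intro * UNIV_I)+
qed

text \<open>Substituting \<open>t \<mapsto> s\<^sup>3\<close> makes the three small critical points of \<open>J\<close> power series in \<open>s\<close>.\<close>

abbreviation cubed :: "complex fps \<Rightarrow> complex fps" where
  "cubed c \<equiv> c oo fps_X ^ 3"

text \<open>The image of the polynomials in \<open>t\<close> under \<open>t = s^3\<close>. Working
  over its fraction field, and not over that of the polynomials in \<open>s\<close>, lets relations
  descend to \<open>t\<close>.\<close>

definition cubed_polynomials :: "complex fps set" where
  "cubed_polynomials = cubed ` finite_series UNIV"

lemma unital_hom_cubed: "unital_hom cubed"
  by (rule unital_hom_fps_compose) simp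

lemma inj_cubed: "inj cubed"
proof (rule injI)
  interpret unital_hom cubed by (rule unital_hom_cubed)
  fix c d assume "cubed c = cubed d"
  then have "cubed (c - d) = 0" by (simp add: homs)
  then show "c = d"
    using fps_compose_eq_0_iff[of "fps_X ^ 3" "c - d"] by auto
qed

lemma subring_set_cubed_polynomials: "subring_set cubed_polynomials"
proof -
  interpret unital_hom cubed by (rule unital_hom_cubed)
  note S = subring_setD[OF subring_set_finite_series[OF subring_set_UNIV]]
  show ?thesis
    unfolding subring_set_def cubed_polynomials_def
  proof (intro conjI ballI)
    show "1 \<in> cubed ` finite_series UNIV"
      by (rule image_eqI[of _ _ 1]) (use S in \<open>simp_all add: homs\<close>)
    fix x y assume "x \<in> cubed ` finite_series UNIV" "y \<in> cubed ` finite_series UNIV"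
    then obtain a b where ab: "x = cubed a" "y = cubed b" "a \<in> finite_series UNIV" "b \<in> finite_series UNIV"
      by auto
    show "x - y \<in> cubed ` finite_series UNIV"
      by (rule image_eqI[of _ _ "a - b"]) (use ab S in \<open>simp_all add: homs\<close>)
    show "x * y \<in> cubed ` finite_series UNIV"
      by (rule image_eqI[of _ _ "a * b"]) (use ab S in \<open>simp_all add: homs\<close>)
  qed
qed

text \<open>A relation with coefficients in \<open>cubed_polynomials\<close> is pulled back along
  \<open>cubed\<close> to a relation in \<open>t\<close>, then pushed forward along
  \<open>embed_t\<close>.\<close>

lemma algebraic_embed_t:
  assumes "algebraic_over (fracs cubed_polynomials) (to_fract (cubed c))"
  shows "algebraic_series (embed_t c)"
proof -
  obtain p where p: "p \<noteq> 0" "\<And>i. Polynomial.coeff p i \<in> cubed ` finite_series UNIV" "poly p (cubed c) = 0"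
    using assms[unfolded algebraic_over_fracs_iff[OF subring_set_cubed_polynomials]]
    unfolding cubed_polynomials_def by blast
  obtain q where q: "q \<noteq> 0" "\<And>i. Polynomial.coeff q i \<in> finite_series UNIV" "poly q c = 0"
    using hom_preimage_of_relation[OF unital_hom_cubed inj_cubed p] by blast
  interpret unital_hom embed_t by (rule unital_hom_embed_t)
  have "map_poly embed_t q \<noteq> 0"
    using q(1) injD[OF inj_embed_t, of _ 0] by (auto simp: poly_eq_iff coeff_map_poly homs)
  moreover have "polynomial_series (Polynomial.coeff (map_poly embed_t q) i)" for i
    using polynomial_series_embed_t[OF q(2)] by (simp add: coeff_map_poly homs)
  moreover have "poly (map_poly embed_t q) (embed_t c) = 0"
    using poly_map_poly[of q c] q(3) by (simp add: homs)
  ultimately show ?thesis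
    unfolding algebraic_series_def rational_functions_eq
      algebraic_over_fracs_iff[OF subring_set_polynomial_series] by blast
qed

text \<open>The last equation is \<open>J'(y) = 0\<close> cleared of denominators, with
  \<open>t = s^3\<close>. Its cube root reads \<open>y = s R(y)\<close>, where
  \<open>R^3 = 2 + \<lambda> y + 2 y^4\<close> and \<open>R(0) = m\<close>, and is solved by
  inverting \<open>y / R(y)\<close> under composition.\<close>

lemma critical_point_series:
  assumes "m ^ 3 = 2"
  obtains Y :: "complex fps" where "Y $ 0 = 0" "Y $ 1 = m"
    "Y ^ 3 = fps_X ^ 3 * (2 + fps_const l * Y + 2 * Y ^ 4)"
proof -
  define P where "P = 2 + fps_const l * fps_X + 2 * fps_X ^ 4"
  define R where "R = fps_radical (\<lambda>_ _. m) 3 P"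
  have m0: "m \<noteq> 0" using assms by auto
  have "P $ 0 = 2" by (simp add: P_def)
  then have R3: "R ^ 3 = P"
    using power_radical[of P "\<lambda>_ _. m" 2] assms by (simp add: R_def numeral_3_eq_3)
  have R0: "R $ 0 = m" by (simp add: R_def)
  define G where "G = fps_X * inverse R"
  have G: "G $ 0 = 0" "G $ 1 \<noteq> 0" using m0 R0 by (simp_all add: G_def)
  define Y where "Y = fps_inv G"
  have GY: "G oo Y = fps_X" unfolding Y_def by (rule fps_inv_right[OF G])
  have Y0: "Y $ 0 = 0" by (simp add: Y_def fps_inv_def)
  interpret unital_hom "\<lambda>a. a oo Y" by (rule unital_hom_fps_compose[OF Y0])
  have "G * R = fps_X"
    using R0 m0 by (simp add: G_def mult.assoc inverse_mult_eq_1)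
  then have "fps_X * (R oo Y) = Y"
    using hom_mult[of G R] GY Y0 by (simp add: fps_X_fps_compose_startby0)
  then have Y: "Y = fps_X * (R oo Y)" by simp
  have "Y $ 1 = m" by (subst Y) (simp add: R0)
  moreover have "Y ^ 3 = fps_X ^ 3 * (P oo Y)"
    by (subst Y) (simp add: power_mult_distrib R3 flip: hom_power)
  moreover have "P oo Y = 2 + fps_const l * Y + 2 * Y ^ 4"
    by (simp only: P_def homs) (simp add: fps_X_fps_compose_startby0 Y0)
  ultimately show ?thesis using that Y0 by metis
qed

text \<open>\<open>y\<close> times the derivative of the cubic equation, minus three times the equation itself.\<close>

lemma euler_combination:
  fixes y t L v w U c r j :: "'a::comm_ring_1"
  assumes j: "j = t + L * t * y + y^3 - t * y^4"
    and eq: "(j - t * (v^2 + L * y * v + c * y^2)) * (v - y * U) = y^3 * r"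
    and deriv: "((L * t + 3 * y^2 - 4 * t * y^3) - t * (2 * v * w + L * (v + y * w) + 2 * c * y)) * (v - y * U)
      + (j - t * (v^2 + L * y * v + c * y^2)) * (w - U) = 3 * y^2 * r"
  shows "(y^3 - 2 * t * y^4 - 2 * t - L * t * y) * (v - y * U) =
    (y * w - v) * (t * (2 * v + L * y) * (v - y * U) - (j - t * (v^2 + L * y * v + c * y^2)))"
proof -
  let ?W = "j - t * (v^2 + L * y * v + c * y^2)"
  have "(y^3 - 2 * t * y^4 - 2 * t - L * t * y) * (v - y * U) -
      (y * w - v) * (t * (2 * v + L * y) * (v - y * U) - ?W) =
    y * (((L * t + 3 * y^2 - 4 * t * y^3) - t * (2 * v * w + L * (v + y * w) + 2 * c * y)) * (v - y * U)
      + ?W * (w - U)) - 3 * (?W * (v - y * U))"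
    unfolding j by (simp add: algebra_simps eval_nat_numeral)
  also have "\<dots> = 0"
    unfolding eq deriv by (simp add: algebra_simps eval_nat_numeral)
  finally show ?thesis by simp
qed

text \<open>By the chain rule \<open>J'(y) = \<Phi>'(V) V'(y)\<close>. At a critical point of
  \<open>J\<close> the factor \<open>V'\<close> is nonzero, so \<open>\<Phi>'(V)\<close> vanishes;
  the second conclusion is this fact cleared of denominators.\<close>

lemma double_root_at_critical_point:
  fixes U c r Y :: "complex fps"
  assumes eq: "(J_num l - tvar * (V_num l^2 + const3 l * yvar * V_num l + embed_t c * yvar^2))
      * (V_num l - yvar * embed_t U) = yvar^3 * embed_t r"
    and Y: "Y $ 0 = 0" "Y ^ 3 = fps_X ^ 3 * (2 + fps_const l * Y + 2 * Y ^ 4)"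
  defines "t \<equiv> fps_X ^ 3" and "v \<equiv> eval_Yt Y (V_num l)"
  defines "j \<equiv> t + fps_const l * t * Y + Y^3 - t * Y^4"
  shows "(j - t * (v^2 + fps_const l * Y * v + cubed c * Y^2)) * (v - Y * cubed U) = Y^3 * cubed r"
    and "t * (2 * v + fps_const l * Y) * (v - Y * cubed U)
      = j - t * (v^2 + fps_const l * Y * v + cubed c * Y^2)"
proof -
  interpret unital_hom "eval_Yt Y" by (rule unital_hom_eval_Yt[OF Y(1)])
  note evals = homs eval_Yt_vars[OF Y(1)] eval_Yt_embed_t[OF Y(1)]
  have J: "J_num l = tvar + const3 l * tvar * yvar + yvar^3 - tvar * yvar^4"
    by (rule J_num_def)
  have j: "eval_Yt Y (J_num l) = j"
    by (simp add: J evals j_def t_def)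
  define V where "V = V_num l"
  define w where "w = deriv_Y V"
  \<comment> \<open>The derivative of the cubic equation in \<open>y\<close>; the series in
    \<open>t\<close> alone behave as constants.\<close>
  have deriv: "((const3 l * tvar + 3 * yvar^2 - 4 * tvar * yvar^3)
        - tvar * (2 * V * w + const3 l * (V + yvar * w) + 2 * embed_t c * yvar)) * (V - yvar * embed_t U)
      + (J_num l - tvar * (V^2 + const3 l * yvar * V + embed_t c * yvar^2)) * (w - embed_t U)
      = 3 * yvar^2 * embed_t r"
    using arg_cong[OF eq, of deriv_Y] unfolding J V_def[symmetric]
    by (simp add: eval_nat_numeral deriv_Y_add deriv_Y_diff deriv_Y_mult deriv_Y_yvar deriv_Y_consts
        deriv_Y_embed_t w_def[symmetric]) (simp add: algebra_simps)
  have "eval_Yt Y ((yvar^3 - 2 * tvar * yvar^4 - 2 * tvar - const3 l * tvar * yvar) * (V - yvar * embed_t U)) =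
    eval_Yt Y ((yvar * w - V) * (tvar * (2 * V + const3 l * yvar) * (V - yvar * embed_t U)
      - (J_num l - tvar * (V^2 + const3 l * yvar * V + embed_t c * yvar^2))))"
    by (rule arg_cong[OF euler_combination[OF J eq[folded V_def] deriv]])
  then have "(Y^3 - 2 * t * Y^4 - 2 * t - fps_const l * t * Y) * (v - Y * cubed U) =
    (Y * eval_Yt Y w - v) * (t * (2 * v + fps_const l * Y) * (v - Y * cubed U)
      - (j - t * (v^2 + fps_const l * Y * v + cubed c * Y^2)))"
    by (simp only: evals j v_def t_def V_def)
  \<comment> \<open>This expression is \<open>t y^3 J'(y)\<close> at the critical point.\<close>
  moreover have "Y^3 - 2 * t * Y^4 - 2 * t - fps_const l * t * Y = 0"
    using Y(2) by (simp add: t_def algebra_simps)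
  \<comment> \<open>This expression is \<open>y^2 V'(y)\<close>; its constant term is
    \<open>-1\<close> because \<open>V\<close> starts with \<open>1 / y\<close>.\<close>
  moreover have "Y * eval_Yt Y w - v \<noteq> 0"
  proof -
    have "v $ 0 = 1"
      using Y(1) by (simp add: v_def V_num_def evals)
    then have "(Y * eval_Yt Y w - v) $ 0 = -1" using Y(1) by simp
    then show ?thesis by (metis fps_zero_nth neg_equal_0_iff_equal zero_neq_one)
  qed
  ultimately show "t * (2 * v + fps_const l * Y) * (v - Y * cubed U)
      = j - t * (v^2 + fps_const l * Y * v + cubed c * Y^2)"
    by simp
  show "(j - t * (v^2 + fps_const l * Y * v + cubed c * Y^2)) * (v - Y * cubed U) = Y^3 * cubed r"
    using arg_cong[OF eq, of "eval_Yt Y"] by (simp only: evals j v_def t_def)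
qed

lemma clear_denominators:
  fixes j t l c u v y :: "'a::field"
  assumes "t \<noteq> 0" "y \<noteq> 0"
  defines "w \<equiv> j - t * (v^2 + l * y * v + c * y^2)"
  shows "((v / y)^2 + l * (v / y) + c - j / (t * y^2)) * (v / y - u) = - (w * (v - y * u) / (t * y^3))"
    and "(2 * (v / y) + l) * (v / y - u) + ((v / y)^2 + l * (v / y) + c - j / (t * y^2)) =
      (t * (2 * v + l * y) * (v - y * u) - w) / (t * y^2)"
proof -
  have 1: "(v / y)^2 + l * (v / y) + c - j / (t * y^2) = - (w / (t * y^2))"
    using assms(1,2) by (simp add: w_def field_simps power2_eq_square)
  have 2: "v / y - u = (v - y * u) / y"
    using assms(2) by (simp add: field_simps)
  show "((v / y)^2 + l * (v / y) + c - j / (t * y^2)) * (v / y - u) = - (w * (v - y * u) / (t * y^3))"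
    unfolding 1 2 by (simp add: power2_eq_square power3_eq_cube mult_ac)
  have 3: "2 * (v / y) + l = t * (2 * v + l * y) / (t * y)"
    using assms(1,2) by (simp add: field_simps)
  show "(2 * (v / y) + l) * (v / y - u) + ((v / y)^2 + l * (v / y) + c - j / (t * y^2)) =
      (t * (2 * v + l * y) * (v - y * u) - w) / (t * y^2)"
    unfolding 1 unfolding 2 unfolding 3 by (simp add: diff_divide_distrib[of _ w] power2_eq_square mult_ac)
qed

text \<open>The three cube roots of 2 yield three critical points, algebraic in \<open>t\<close>,
  with distinct critical values. The double root criterion, applied to \<open>V\<close> at these
  points, gives the coefficients without knowing \<open>V\<close>.\<close>

lemma algebraic_coefficients:
  assumes eq: "(J_num l - tvar * (V_num l^2 + const3 l * yvar * V_num l + embed_t c * yvar^2))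
      * (V_num l - yvar * embed_t U) = yvar^3 * embed_t r"
  shows "algebraic_series (embed_t U) \<and> algebraic_series (embed_t c) \<and> algebraic_series (embed_t r)"
proof -
  let ?K = "fracs cubed_polynomials"
  let ?S = "{z::complex. z ^ 3 = 2}"
  have K: "subfield ?K type_ring" by (rule subfield_fracs[OF subring_set_cubed_polynomials])
  note alg = algebraic_over_intros[OF K]
  have "card ?S = 3" by (rule card_nth_roots) simp_all
  then obtain m :: "nat \<Rightarrow> complex" where m: "bij_betw m {0..<3} ?S"
    using ex_bij_betw_nat_finite[of ?S] card_ge_0_finite[of ?S] by auto
  have m3: "m k ^ 3 = 2" if "k < 3" for k
    using bij_betwE[OF m] that by auto
  have "\<exists>Y. Y $ 0 = 0 \<and> Y $ 1 = m k \<and> Y ^ 3 = fps_X ^ 3 * (2 + fps_const l * Y + 2 * Y ^ 4)"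
    if "k < 3" for k
    using critical_point_series[OF m3[OF that], of l] by metis
  then obtain Y where Y: "\<And>k. k < 3 \<Longrightarrow> Y k $ 0 = 0" "\<And>k. k < 3 \<Longrightarrow> Y k $ 1 = m k"
    "\<And>k. k < 3 \<Longrightarrow> Y k ^ 3 = fps_X ^ 3 * (2 + fps_const l * Y k + 2 * Y k ^ 4)"
    by metis
  define t :: "complex fps" where "t = fps_X ^ 3"
  define j where "j k = t + fps_const l * t * Y k + Y k^3 - t * Y k^4" for k
  define v where "v k = eval_Yt (Y k) (V_num l)" for k
  \<comment> \<open>The critical value \<open>J(Y k)\<close>.\<close>
  define e where "e k = to_fract (j k) / (to_fract t * to_fract (Y k)^2)" for k
  have t0: "t \<noteq> 0" by (simp add: t_def)
  have Y_nz: "Y k \<noteq> 0" if "k < 3" for k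
    using Y(2)[OF that] m3[OF that] by auto
  have in_K: "algebraic_over ?K (to_fract (cubed a))" if "a \<in> finite_series UNIV" for a
    using that by (intro algebraic_over_in[OF K] to_fract_in_fracs subring_set_cubed_polynomials)
      (simp add: cubed_polynomials_def)
  have "algebraic_over ?K (to_fract (cubed fps_X))"
    by (intro in_K fps_X_in_finite_series subring_set_UNIV)
  then have alg_t: "algebraic_over ?K (to_fract t)"
    by (simp add: t_def fps_X_fps_compose_startby0)
  have "algebraic_over ?K (to_fract (cubed (fps_const l)))"
    by (intro in_K fps_const_in_finite_series subring_set_UNIV UNIV_I)
  then have alg_l: "algebraic_over ?K (to_fract (fps_const l))" by simp
  have alg_Y: "algebraic_over ?K (to_fract (Y k))" if "k < 3" for k
  proof (rule algebraic_over_root[OF K])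
    let ?p = "[:- 2 * to_fract t, - to_fract t * to_fract (fps_const l), 0, 1, - 2 * to_fract t:]"
    show "?p \<noteq> 0" by simp
    have "to_fract (Y k ^ 3) = to_fract (t * (2 + fps_const l * Y k + 2 * Y k ^ 4))"
      using Y(3)[OF that] by (simp add: t_def)
    then have "to_fract (Y k)^3 = to_fract t * (2 + to_fract (fps_const l) * to_fract (Y k)
        + 2 * to_fract (Y k)^4)"
      by (simp only: to_fract_power to_fract_mult to_fract_add to_fract_numeral)
    then show "poly ?p (to_fract (Y k)) = 0"
      by (simp add: algebra_simps eval_nat_numeral)
    have "algebraic_over ?K (- 2 * to_fract t)" "algebraic_over ?K (- to_fract t * to_fract (fps_const l))"
      by (intro alg alg_t alg_l)+
    then show "\<forall>c\<in>set (coeffs ?p). algebraic_over ?K c"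
      using alg(1,2) by (auto simp: cCons_def)
  qed
  have "algebraic_over ?K (e k)" if "k < 3" for k
  proof -
    have "to_fract (j k) = to_fract t + to_fract (fps_const l) * to_fract t * to_fract (Y k)
        + to_fract (Y k)^3 - to_fract t * to_fract (Y k)^4"
      by (simp add: j_def to_fract_power)
    then show ?thesis
      unfolding e_def by (simp only:) (intro alg alg_t alg_l alg_Y that)
  qed
  moreover have "inj_on e {..<3}"
  proof (rule inj_onI)
    fix i k :: nat assume "i \<in> {..<3}" "k \<in> {..<3}" and ik: "e i = e k"
    then have i: "i < 3" and k: "k < 3" by auto
    have "to_fract (j i * Y k^2) = to_fract (j k * Y i^2)"
      using ik t0 Y_nz[OF i] Y_nz[OF k] by (simp add: e_def field_simps to_fract_power)
    then have *: "j i * Y k^2 = j k * Y i^2" by (simp only: to_fract_eq_iff)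
    have shift: "\<exists>Z. Y n = fps_X * Z \<and> Z $ 0 = m n" if "n < 3" for n
      using Y(1,2)[OF that] by (intro exI[of _ "fps_shift 1 (Y n)"]) (auto simp: fps_eq_iff)
    obtain P where P: "Y i = fps_X * P" "P $ 0 = m i" using shift[OF i] by auto
    obtain R where R: "Y k = fps_X * R" "R $ 0 = m k" using shift[OF k] by auto
    \<comment> \<open>Each \<open>j\<close> contributes \<open>s^3\<close> and each squared
      \<open>Y\<close> contributes \<open>s^2\<close>. Comparing constant terms leaves
      \<open>m k^2 = m i^2\<close>, as \<open>1 + m^3 = 3\<close>; equal squares and equal cubes
      force equal roots.\<close>
    have "fps_X ^ 5 * ((1 + fps_const l * Y i + P^3 - Y i^4) * R^2)
        = fps_X ^ 5 * ((1 + fps_const l * Y k + R^3 - Y k^4) * P^2)"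
      using * unfolding j_def t_def by (simp add: P(1) R(1) algebra_simps eval_nat_numeral)
    then have "((1 + fps_const l * Y i + P^3 - Y i^4) * R^2) $ 0 = ((1 + fps_const l * Y k + R^3 - Y k^4) * P^2) $ 0"
      by simp
    then have "3 * m k^2 = 3 * m i^2"
      using m3[OF i] m3[OF k] Y(1)[OF i] Y(1)[OF k] by (simp add: P(2) R(2) fps_power_zeroth)
    then have "m k^2 = m i^2" by simp
    moreover have "m k^2 * m k = m i^2 * m i" "m i \<noteq> 0"
      using m3[OF i] m3[OF k] by (auto simp: power3_eq_cube power2_eq_square)
    ultimately have "m k = m i" by simp
    then show "i = k"
      using bij_betw_imp_inj_on[OF m] i k by (auto dest: inj_onD)
  qed
  moreover have "((to_fract (v k) / to_fract (Y k))^2 + to_fract (fps_const l) * (to_fract (v k) / to_fract (Y k))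
        + to_fract (cubed c) - e k) * (to_fract (v k) / to_fract (Y k) - to_fract (cubed U))
      = - (to_fract (cubed r) / to_fract t)" if "k < 3" for k
  proof -
    have "to_fract ((j k - t * (v k^2 + fps_const l * Y k * v k + cubed c * Y k^2)) * (v k - Y k * cubed U))
        = to_fract (Y k^3 * cubed r)"
      using double_root_at_critical_point(1)[OF eq Y(1,3)[OF that]] by (simp only: j_def t_def v_def)
    then show ?thesis
      using t0 Y_nz[OF that] unfolding e_def
      by (subst clear_denominators) (simp_all add: to_fract_power)
  qed
  moreover have "(2 * (to_fract (v k) / to_fract (Y k)) + to_fract (fps_const l))
        * (to_fract (v k) / to_fract (Y k) - to_fract (cubed U))
      + ((to_fract (v k) / to_fract (Y k))^2 + to_fract (fps_const l) * (to_fract (v k) / to_fract (Y k))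
        + to_fract (cubed c) - e k) = 0" if "k < 3" for k
  proof -
    have "to_fract (t * (2 * v k + fps_const l * Y k) * (v k - Y k * cubed U))
        = to_fract (j k - t * (v k^2 + fps_const l * Y k * v k + cubed c * Y k^2))"
      using double_root_at_critical_point(2)[OF eq Y(1,3)[OF that]] by (simp only: j_def t_def v_def)
    then show ?thesis
      using t0 Y_nz[OF that] unfolding e_def
      by (subst clear_denominators) (simp_all add: to_fract_power to_fract_numeral)
  qed
  ultimately have *: "algebraic_over ?K (to_fract (cubed U)) \<and> algebraic_over ?K (to_fract (cubed c))
      \<and> algebraic_over ?K (- (to_fract (cubed r) / to_fract t))"
    by (intro algebraic_over_double_roots[OF K alg_l, of e "\<lambda>k. to_fract (v k) / to_fract (Y k)"])
  have "algebraic_over ?K (- (- (to_fract (cubed r) / to_fract t)) * to_fract t)"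
    by (intro algebraic_over_mult[OF K] algebraic_over_uminus[OF K, of "- _"] alg_t
        conjunct2[OF conjunct2[OF *]])
  then have "algebraic_over ?K (to_fract (cubed r))"
    using t0 by simp
  then show ?thesis using * algebraic_embed_t by blast
qed

section \<open>Algebraic series and the conclusion\<close>

lemma algebraic_series_polynomial: "polynomial_series F \<Longrightarrow> algebraic_series F"
  unfolding algebraic_series_def rational_functions_eq
  by (intro algebraic_over_in subfield_fracs to_fract_in_fracs subring_set_polynomial_series) simp_all

lemmas algebraic_over_rational_intros = algebraic_over_intros[OF subfield_rational_functions]

lemma
  shows algebraic_series_1: "algebraic_series 1"
    and algebraic_series_numeral: "algebraic_series (numeral k)"
    and algebraic_series_add: "algebraic_series F \<Longrightarrow> algebraic_series G \<Longrightarrow> algebraic_series (F + G)"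
    and algebraic_series_diff: "algebraic_series F \<Longrightarrow> algebraic_series G \<Longrightarrow> algebraic_series (F - G)"
    and algebraic_series_uminus: "algebraic_series F \<Longrightarrow> algebraic_series (- F)"
    and algebraic_series_mult: "algebraic_series F \<Longrightarrow> algebraic_series G \<Longrightarrow> algebraic_series (F * G)"
    and algebraic_series_power: "algebraic_series F \<Longrightarrow> algebraic_series (F ^ n)"
  unfolding algebraic_series_def
  by (simp_all add: to_fract_power to_fract_numeral algebraic_over_rational_intros)

lemmas algebraic_series_intros = algebraic_series_1 algebraic_series_numeral algebraic_series_add
  algebraic_series_diff algebraic_series_uminus algebraic_series_mult algebraic_series_power
  polynomial_series_vars[THEN algebraic_series_polynomial]

lemma algebraic_series_cancel:
  assumes "algebraic_series (F * G)" "algebraic_series F" "F \<noteq> 0"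
  shows "algebraic_series G"
proof -
  have "to_fract G = to_fract (F * G) / to_fract F" using assms(3) by simp
  then show ?thesis
    using algebraic_over_divide[OF subfield_rational_functions] assms(1,2)
    unfolding algebraic_series_def by metis
qed

lemma algebraic_series_cubic:
  assumes "algebraic_series a" "algebraic_series b" "algebraic_series c" "algebraic_series d"
    "algebraic_series e" "a \<noteq> 0" "(b - a * F^2 - c * F) * (F - d) = e"
  shows "algebraic_series F"
  unfolding algebraic_series_def
proof (rule algebraic_over_cubic[OF subfield_rational_functions])
  show "(to_fract b - to_fract a * to_fract F ^ 2 - to_fract c * to_fract F) * (to_fract F - to_fract d) = to_fract e"
    by (simp add: to_fract_power flip: assms(7))
qed (use assms in \<open>simp_all add: algebraic_series_def\<close>)

theorem mainTheorem7:
  fixes l :: complex and Q :: series3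
  assumes "l \<noteq> 0"
  defines "Q \<equiv> walk_series G_steps (G_weight l)"
  shows "algebraic_series (subst_Y0 Q) \<and> algebraic_series (subst_X0 Q) \<and> algebraic_series Q"
proof -
  have Q: "G_series l = Q" by (simp add: Q_def G_series_def)
  let ?L = "const3 l" and ?a = "1 + xvar^2"
  obtain U c r where U: "U = - tvar * subst_X0 (subst_Y0 Q)"
    and const: "subst_Y0 U = U" "subst_X0 U = U" "subst_Y0 c = c" "subst_X0 c = c" "subst_Y0 r = r" "subst_X0 r = r"
    and eqV: "(J_num l - tvar * (V_num l^2 + ?L * yvar * V_num l + c * yvar^2)) * (V_num l - yvar * U)
      = yvar^3 * r"
    and eqU: "(I_num l - xvar * (U_num l^2 + ?L * tvar * ?a * U_num l + c * tvar^2 * ?a^2))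
      * (U_num l - tvar * ?a * U) = xvar * ?a^3 * tvar^2 * r"
    by (rule cubic_equations[of l]) (simp only: Q)
  \<comment> \<open>Invariance under both specializations means dependence on \<open>t\<close>
    only.\<close>
  obtain U' c' r' where embed: "U = embed_t U'" "c = embed_t c'" "r = embed_t r'"
    using const by (metis embed_tE)
  have coeffs: "algebraic_series U" "algebraic_series c" "algebraic_series r"
    using algebraic_coefficients[of l c' U' r'] eqV unfolding embed by blast+
  note alg = algebraic_series_intros coeffs
  have IJ: "algebraic_series (I_num l)" "algebraic_series (J_num l)"
    unfolding I_num_def J_num_def by (intro alg)+
  have a0: "?a \<noteq> 0" using one_plus_xvar2_unit by auto
  have "algebraic_series (V_num l)"
  proof (rule algebraic_series_cubic)
    show "(J_num l - tvar * c * yvar^2 - tvar * V_num l^2 - tvar * ?L * yvar * V_num l) * (V_num l - yvar * U)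
        = yvar^3 * r"
      unfolding eqV[symmetric] by (simp add: algebra_simps)
  qed (intro alg IJ | simp)+
  moreover have "algebraic_series (U_num l)"
  proof (rule algebraic_series_cubic)
    show "(I_num l - xvar * c * tvar^2 * ?a^2 - xvar * U_num l^2 - xvar * ?L * tvar * ?a * U_num l)
        * (U_num l - tvar * ?a * U) = xvar * ?a^3 * tvar^2 * r"
      unfolding eqU[symmetric] by (simp add: algebra_simps)
  qed (intro alg IJ xvar_nonzero)+
  ultimately have UV: "algebraic_series (U_num l)" "algebraic_series (V_num l)" by auto
  \<comment> \<open>The definition of \<open>U_num\<close> is solved for \<open>Q(x, 0)\<close>;
    below, \<open>U\<close> gives \<open>Q(0, 0)\<close>, and then \<open>V_num\<close> gives
    \<open>Q(0, y)\<close>.\<close>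
  have "tvar^2 * ?a^2 * subst_Y0 Q = xvar * (1 - ?L * tvar * xvar) - U_num l"
    by (simp add: U_num_def Q)
  then have "algebraic_series (tvar^2 * ?a^2 * subst_Y0 Q)"
    by (simp only:) (intro alg UV)
  then have X: "algebraic_series (subst_Y0 Q)"
    by (rule algebraic_series_cancel) (use a0 in \<open>(intro alg | simp)+\<close>)
  have "tvar * subst_X0 (subst_Y0 Q) = - U" by (simp add: U)
  then have "algebraic_series (tvar * subst_X0 (subst_Y0 Q))"
    by (simp only:) (intro alg)
  then have Z: "algebraic_series (subst_X0 (subst_Y0 Q))"
    by (rule algebraic_series_cancel) (intro alg | simp)+
  have "yvar * tvar * subst_X0 Q = V_num l - 1 + yvar * tvar * subst_X0 (subst_Y0 Q)"
    by (simp add: V_num_def Q algebra_simps)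
  then have "algebraic_series (yvar * tvar * subst_X0 Q)"
    by (simp only:) (intro alg UV Z)
  then have Y: "algebraic_series (subst_X0 Q)"
    by (rule algebraic_series_cancel) (use yvar_nonzero in \<open>(intro alg | simp)+\<close>)
  \<comment> \<open>The monomial \<open>x y\<close> survives at \<open>t = 0\<close>, so the kernel
    is nonzero and the functional equation determines \<open>Q\<close> from its
    specializations.\<close>
  have "walk_kernel l $ 0 $ 1 $ 1 \<noteq> 0"
    by (simp add: kernel_eq xvar_def yvar_def)
  then have kernel: "walk_kernel l \<noteq> 0" by auto
  have kernel_alg: "algebraic_series (walk_kernel l)"
    unfolding walk_kernel_def by (intro alg)
  have "algebraic_series (walk_kernel l * Q)"
    using functional_equation[of l] unfolding Q by (simp only:) (intro alg X Y Z)
  then have "algebraic_series Q"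
    by (rule algebraic_series_cancel[OF _ kernel_alg kernel])
  then show ?thesis using X Y by blast
qed

end
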